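(* Let $\{F^{ij}\}_{1\le i<j\le 4}$ be a sextuple of real fundamental matrices such that, for each $i\in\{1,2,3,4\}$, the three epipoles $e_i^j$ ($j\ne i$) in the $i$-th image are distinct points lying on a line in $\mathbb{P}^2$. For each $i$, let $\mathbf{x}_i:=F^{ij}e_j^l$, where $j<k<l$ and $\{i,j,k,l\}=\{1,2,3,4\}$; that is, $\mathbf{x}_1=F^{12}e_2^4$, $\mathbf{x}_2=F^{21}e_1^4$, $\mathbf{x}_3=F^{31}e_1^4$, $\mathbf{x}_4=F^{41}e_1^3$. Then $\{F^{ij}\}$ is compatible if and only if all of the following hold: (1) the triple-wise conditions hold for every three distinct indices in $\{1,2,3,4\}$; (2) for all $i,j,k,l$ with $\{i,j,k,l\}=\{1,2,3,4\}$ and $j<k<l$, $$\langle F^{jk}e_k^i,F^{jl}e_l^i \rangle \langle F^{kj}e_j^i,F^{kl}e_l^i \rangle\langle F^{lj}e_j^i,F^{lk}e_k^i \rangle +\|F^{lj}e_j^i\|^2\|F^{jk}e_k^i\|^2\|F^{kl}e_l^i\|^2 =0;$$ (3) $$-\frac{e_2^3F^{24}\mathbf{x}_4}{\mathbf{x}_2F^{24}e_4^1}\frac{\mathbf{x}_1F^{12}\mathbf{x}_2}{\mathbf{x}_1F^{12}e_2^3}+\frac{e_3^2F^{34}\mathbf{x}_4}{\mathbf{x}_3F^{34}e_4^1}\frac{\mathbf{x}_1F^{13}\mathbf{x}_3}{\mathbf{x}_1F^{13}e_3^2}+\frac{e_3^1F^{34}\mathbf{x}_4}{\mathbf{x}_3F^{34}e_4^1}\frac{\mathbf{x}_2F^{23}\mathbf{x}_3}{\mathbf{x}_2F^{23}e_3^1}-\frac{e_3^2F^{34}\mathbf{x}_4}{e_1^2F^{14}\mathbf{x}_4}\frac{e_1^2F^{13}\mathbf{x}_3}{\mathbf{x}_1F^{13}e_3^2}\frac{\mathbf{x}_1F^{14}\mathbf{x}_4}{\mathbf{x}_3F^{34}e_4^1}+\frac{\mathbf{x}_2F^{24}\mathbf{x}_4}{\mathbf{x}_2F^{24}e_4^1}-\frac{\mathbf{x}_3F^{34}\mathbf{x}_4}{\mathbf{x}_3F^{34}e_4^1}=0,$$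 where for vectors $u,v\in\mathbb{R}^3$ the expression $uF^{ij}v$ means $u^TF^{ij}v$.
   Context: Everything is over $\mathbb{R}$; $\langle\cdot,\cdot\rangle$ and $\|\cdot\|$ are the standard inner product and norm on $\mathbb{R}^3$. A camera is a rank-3 real $3\times 4$ matrix (up to nonzero scale); its center is its kernel, a point of $\mathbb{P}^3$. A fundamental matrix is a rank-2 real $3\times 3$ matrix (up to nonzero scale). For $3\times 4$ matrices $P_1,P_2$, $\psi(P_1,P_2)$ is the $3\times3$ matrix $F$ (up to scale) with $\det\begin{bmatrix}P_1&x&0\\P_2&0&y\end{bmatrix}=x^TFy$ for all $x,y\in\mathbb{R}^3$. Affine representatives of the fundamental matrices are fixed with $F^{ji}=(F^{ij})^T$. A set $\{F^{ij}\}$ is compatible if there are cameras $P_1,\dots,P_n$ with $F^{ij}=\psi(P_i,P_j)$ up to nonzero scale for all given $(i,j)$. The epipole $e_j^i\in\mathbb{R}^3$ (the $i$-th epipole in the $j$-th image) is a fixed nonzero vector spanning $\ker F^{ij}$; equalities between epipoles are up to nonzero scale. The triple-wise conditions for three distinct indices $i,j,k$: either (non-collinear) the two epipoles in each of the three images are distinct, i.e. $e_i^j\ne e_i^k$, $e_j^i\neq e_j^k$, $e_k^i\ne e_k^j$, and $(e_i^k)^TF^{ij}e_j^k=(e_i^j)^TF^{ik}e_k^j=(e_j^i)^TF^{jk}e_k^i=0$; or (collinear) $e_i^j=e_i^k$, $e_j^i=e_j^k$, $e_k^i=e_k^j$ and $(F^{ij})^T[e_i^j]_\times F^{ik}=F^{jk}$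 up to nonzero scale, where $[t]_\times$ is the skew-symmetric matrix with $[t]_\times u=t\times u$. *)

theory Defs
  imports "HOL-Analysis.Analysis"
begin

text \<open>
  Cameras, fundamental matrices and epipoles are represented by affine representatives.
  For two nonzero vectors \<open>same_up_to_scale\<close> says that they are the same projective point.
\<close>

definition same_up_to_scale :: "'a::real_vector \<Rightarrow> 'a \<Rightarrow> bool" where
  "same_up_to_scale a b \<longleftrightarrow> (\<exists>c. c \<noteq> 0 \<and> a = c *\<^sub>R b)"

definition camera :: "real^4^3 \<Rightarrow> bool" where
  "camera P \<longleftrightarrow> rank P = 3"

definition fundamental_matrix :: "real^3^3 \<Rightarrow> bool" where
  "fundamental_matrix F \<longleftrightarrow> rank F = 2"

definition camera_block :: "real^4^3 \<Rightarrow> real^4^3 \<Rightarrow> real^3 \<Rightarrow> real^3 \<Rightarrow> real^6^6" where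
  "camera_block P Q x y = vector
    [vector [P$1$1, P$1$2, P$1$3, P$1$4, x$1, 0],
     vector [P$2$1, P$2$2, P$2$3, P$2$4, x$2, 0],
     vector [P$3$1, P$3$2, P$3$3, P$3$4, x$3, 0],
     vector [Q$1$1, Q$1$2, Q$1$3, Q$1$4, 0, y$1],
     vector [Q$2$1, Q$2$2, Q$2$3, Q$2$4, 0, y$2],
     vector [Q$3$1, Q$3$2, Q$3$3, Q$3$4, 0, y$3]]"

text \<open>The description is well-formed; see \<open>psi_unique\<close> and \<open>det_camera_block\<close> below.\<close>

definition psi :: "real^4^3 \<Rightarrow> real^4^3 \<Rightarrow> real^3^3" where
  "psi P Q = (THE F. \<forall>x y. det (camera_block P Q x y) = x \<bullet> (F *v y))"

definition compatible :: "nat \<Rightarrow> (nat \<Rightarrow> nat \<Rightarrow> real^3^3) \<Rightarrow> bool" where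
  "compatible n F \<longleftrightarrow>
    (\<exists>P. (\<forall>i\<in>{1..n}. camera (P i)) \<and>
         (\<forall>i\<in>{1..n}. \<forall>j\<in>{1..n}. i < j \<longrightarrow> same_up_to_scale (F i j) (psi (P i) (P j))))"

definition is_epipole :: "real^3^3 \<Rightarrow> real^3 \<Rightarrow> bool" where
  "is_epipole F v \<longleftrightarrow> v \<noteq> 0 \<and> {u. F *v u = 0} = span {v}"

definition on_common_line :: "(real^3) set \<Rightarrow> bool" where
  "on_common_line S \<longleftrightarrow> (\<exists>l. l \<noteq> 0 \<and> (\<forall>v\<in>S. l \<bullet> v = 0))"

definition bil :: "real^3 \<Rightarrow> real^3^3 \<Rightarrow> real^3 \<Rightarrow> real" where
  "bil u A v = u \<bullet> (A *v v)"

definition skew :: "real^3 \<Rightarrow> real^3^3" where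
  "skew t = matrix (cross3 t)"

text \<open>
  In the following, \<open>e i j\<close> is the epipole $e_i^j$: the image comes first, then the index
  of the other camera. So \<open>e j i\<close> spans the kernel of \<open>F i j\<close>.
\<close>

definition triple_noncollinear ::
    "(nat \<Rightarrow> nat \<Rightarrow> real^3^3) \<Rightarrow> (nat \<Rightarrow> nat \<Rightarrow> real^3) \<Rightarrow> nat \<Rightarrow> nat \<Rightarrow> nat \<Rightarrow> bool" where
  "triple_noncollinear F e i j k \<longleftrightarrow>
     \<not> same_up_to_scale (e i j) (e i k) \<and>
     \<not> same_up_to_scale (e j i) (e j k) \<and>
     \<not> same_up_to_scale (e k i) (e k j) \<and>
     bil (e i k) (F i j) (e j k) = 0 \<and>
     bil (e i j) (F i k) (e k j) = 0 \<and>
     bil (e j i) (F j k) (e k i) = 0"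

definition triple_collinear ::
    "(nat \<Rightarrow> nat \<Rightarrow> real^3^3) \<Rightarrow> (nat \<Rightarrow> nat \<Rightarrow> real^3) \<Rightarrow> nat \<Rightarrow> nat \<Rightarrow> nat \<Rightarrow> bool" where
  "triple_collinear F e i j k \<longleftrightarrow>
     same_up_to_scale (e i j) (e i k) \<and>
     same_up_to_scale (e j i) (e j k) \<and>
     same_up_to_scale (e k i) (e k j) \<and>
     same_up_to_scale (transpose (F i j) ** skew (e i j) ** F i k) (F j k)"

definition triplewise ::
    "(nat \<Rightarrow> nat \<Rightarrow> real^3^3) \<Rightarrow> (nat \<Rightarrow> nat \<Rightarrow> real^3) \<Rightarrow> nat \<Rightarrow> nat \<Rightarrow> nat \<Rightarrow> bool" where
  "triplewise F e i j k \<longleftrightarrow> triple_noncollinear F e i j k \<or> triple_collinear F e i j k"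

lemma skew_mult: "skew t *v u = cross3 t u"
  unfolding skew_def
  by (simp add: matrix_vector_mult_def matrix_def cross3_def vec_eq_iff forall_3 sum_3 axis_def)

lemma exhaust_6:
  fixes x :: 6
  shows "x = 1 \<or> x = 2 \<or> x = 3 \<or> x = 4 \<or> x = 5 \<or> x = 6"
proof (induct x)
  case (of_int z)
  then have "0 \<le> z" "z < 6" by simp_all
  then have "z = 0 \<or> z = 1 \<or> z = 2 \<or> z = 3 \<or> z = 4 \<or> z = 5" by arith
  then show ?case by auto
qed

lemma forall_6: "(\<forall>i::6. P i) \<longleftrightarrow> P 1 \<and> P 2 \<and> P 3 \<and> P 4 \<and> P 5 \<and> P 6"
  by (metis exhaust_6)

lemma vector_6 [simp]:
  "(vector [a,b,c,d,e,f] :: 'a::zero^6) $ 1 = a"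
  "(vector [a,b,c,d,e,f] :: 'a::zero^6) $ 2 = b"
  "(vector [a,b,c,d,e,f] :: 'a::zero^6) $ 3 = c"
  "(vector [a,b,c,d,e,f] :: 'a::zero^6) $ 4 = d"
  "(vector [a,b,c,d,e,f] :: 'a::zero^6) $ 5 = e"
  "(vector [a,b,c,d,e,f] :: 'a::zero^6) $ 6 = f"
  by (simp_all add: vector_def)

lemma linear_det_camera_block_1: "linear (\<lambda>x. det (camera_block P Q x y))"
proof -
  define r where "r x = (vector [x$1, x$2, x$3, 0, 0, 0] :: real^6)" for x :: "real^3"
  define c where "c = (\<lambda>i. transpose (camera_block P Q 0 y) $ i)"
  have T: "det (camera_block P Q x y) = det (\<chi> i. if i = 5 then r x else c i)" for x
  proof -
    have "transpose (camera_block P Q x y) = (\<chi> i. if i = 5 then r x else c i)"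
      by (simp add: vec_eq_iff forall_6 transpose_def camera_block_def r_def c_def)
    then show ?thesis by (metis det_transpose)
  qed
  have add: "r (x + z) = r x + r z" and scl: "r (s *\<^sub>R x) = s *s r x" for x z s
    by (simp_all add: r_def vec_eq_iff forall_6)
  show ?thesis
    by (rule linearI) (simp_all only: T add scl det_row_add det_row_mul real_scaleR_def)
qed

lemma linear_det_camera_block_2: "linear (\<lambda>y. det (camera_block P Q x y))"
proof -
  define r where "r y = (vector [0, 0, 0, y$1, y$2, y$3] :: real^6)" for y :: "real^3"
  define c where "c = (\<lambda>i. transpose (camera_block P Q x 0) $ i)"
  have T: "det (camera_block P Q x y) = det (\<chi> i. if i = 6 then r y else c i)" for y
  proof -
    have "transpose (camera_block P Q x y) = (\<chi> i. if i = 6 then r y else c i)"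
      by (simp add: vec_eq_iff forall_6 transpose_def camera_block_def r_def c_def)
    then show ?thesis by (metis det_transpose)
  qed
  have add: "r (y + z) = r y + r z" and scl: "r (s *\<^sub>R y) = s *s r y" for y z s
    by (simp_all add: r_def vec_eq_iff forall_6)
  show ?thesis
    by (rule linearI) (simp_all only: T add scl det_row_add det_row_mul real_scaleR_def)
qed

lemma det_camera_block_exists: "\<exists>F. \<forall>x y. det (camera_block P Q x y) = x \<bullet> (F *v y)"
proof -
  define D where "D x y = det (camera_block P Q x y)" for x y
  define F where "F = (\<chi> a b. D (axis a 1) (axis b 1))"
  have ex: "v = (\<Sum>a\<in>UNIV. v $ a *\<^sub>R axis a 1)" for v :: "real^3"
    by (metis basis_expansion scalar_mult_eq_scaleR)
  have "D x y = x \<bullet> (F *v y)" for x y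
  proof -
    have l1: "linear (\<lambda>x. D x z)" and l2: "linear (\<lambda>y. D z y)" for z
      unfolding D_def by (rule linear_det_camera_block_1 linear_det_camera_block_2)+
    have "D x y = (\<Sum>a\<in>UNIV. x $ a * D (axis a 1) y)"
      by (subst ex[of x]) (simp add: linear_sum[OF l1] linear_cmul[OF l1])
    also have "\<dots> = (\<Sum>a\<in>UNIV. x $ a * (\<Sum>b\<in>UNIV. y $ b * D (axis a 1) (axis b 1)))"
    proof -
      have "D z y = (\<Sum>b\<in>UNIV. y $ b * D z (axis b 1))" for z
        by (subst ex[of y]) (simp add: linear_sum[OF l2] linear_cmul[OF l2])
      then show ?thesis by simp
    qed
    also have "\<dots> = x \<bullet> (F *v y)"
      by (simp add: inner_vec_def matrix_vector_mult_def F_def mult.commute)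
    finally show ?thesis .
  qed
  then show ?thesis unfolding D_def by blast
qed

lemma psi_unique:
  assumes "\<forall>x y. det (camera_block P Q x y) = x \<bullet> (F *v y)"
  shows "psi P Q = F"
  unfolding psi_def
proof (rule the_equality[where a = F])
  show "\<forall>x y. det (camera_block P Q x y) = x \<bullet> (F *v y)" by fact
next
  fix G assume "\<forall>x y. det (camera_block P Q x y) = x \<bullet> (G *v y)"
  with assms have "x \<bullet> (G *v y) = x \<bullet> (F *v y)" for x y by simp
  then have "G *v y = F *v y" for y by (metis vector_eq_ldot)
  then show "G = F" by (simp add: matrix_eq)
qed

lemma det_camera_block: "det (camera_block P Q x y) = x \<bullet> (psi P Q *v y)"
  using det_camera_block_exists psi_unique by metis

end

theory Submission
  imports Defs
begin

text \<open>
  Up to scale, \<open>psi P Q\<close> is the only nonzero matrix \<open>G\<close> with \<open>(P z) \<bullet> (G (Q z)) = 0\<close> for all \<open>z\<close>.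
  The four centers lie in a plane, no three on a line, so one may choose representatives
  \<open>c i\<close> with sum zero and rescale cameras and epipoles such that \<open>P i\<close> maps \<open>c j\<close> to \<open>g i j\<close>, the
  epipoles in each image adding up to zero. The only remaining unknowns are the images
  \<open>P i w = (\<Sum>j. y i j g i j) + s i x i\<close> of a point \<open>w\<close> off the plane, where \<open>x i\<close> is a
  normal vector of the line of epipoles. The incidence condition for \<open>F i j\<close> splits into equations
  for the ratio of \<open>s i\<close> and \<open>s j\<close>, solvable iff the products of the ratios around each triangle are
  right, which is (2), and one linear equation in \<open>y\<close> per edge. The six left-hand sides
  in \<open>y\<close> satisfy exactly one linear relation, and (3) says that the right-hand sides satisfy it too.
\<close>

section \<open>The incidence characterization of fundamental matrices\<close>

lemma vector_4:
  "(vector [a, b, c, d] :: 'a::zero^4) $ 1 = a" "(vector [a, b, c, d] :: 'a::zero^4) $ 2 = b"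
  "(vector [a, b, c, d] :: 'a::zero^4) $ 3 = c" "(vector [a, b, c, d] :: 'a::zero^4) $ 4 = d"
  by (simp_all add: vector_def)

text \<open>The six coordinates of a kernel vector of the block matrix split into a point
  \<open>z\<close> and two scalars. The facts on \<open>psi\<close> below rest on this and need no
  expansion of a determinant.\<close>

lemma camera_block_singular_iff:
  "det (camera_block P Q x y) = 0 \<longleftrightarrow>
    (\<exists>z t r. \<not> (z = 0 \<and> t = 0 \<and> r = 0) \<and> P *v z + t *\<^sub>R x = 0 \<and> Q *v z + r *\<^sub>R y = 0)"
proof -
  have S6: "sum f (UNIV :: 6 set) = f 1 + f 2 + f 3 + f 4 + f 5 + f 6" for f :: "6 \<Rightarrow> real"
  proof -
    have U: "(UNIV :: 6 set) = {1,2,3,4,5,6}" using exhaust_6 by auto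
    show ?thesis unfolding U by (simp add: add.assoc)
  qed
  have eq: "camera_block P Q x y *v (vector [z$1, z$2, z$3, z$4, t, r]) = 0 \<longleftrightarrow>
      P *v z + t *\<^sub>R x = 0 \<and> Q *v z + r *\<^sub>R y = 0" for z :: "real^4" and t r
    by (simp add: vec_eq_iff forall_6 forall_3 matrix_vector_mult_def S6 sum_4 camera_block_def algebra_simps)
  have "det (camera_block P Q x y) = 0 \<longleftrightarrow> (\<exists>v. v \<noteq> 0 \<and> camera_block P Q x y *v v = 0)"
    by (metis invertible_det_nz invertible_left_inverse matrix_left_invertible_ker)
  also have "\<dots> \<longleftrightarrow> (\<exists>z t r. \<not> (z = 0 \<and> t = 0 \<and> r = 0) \<and> P *v z + t *\<^sub>R x = 0 \<and> Q *v z + r *\<^sub>R y = 0)"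
  proof
    assume "\<exists>v. v \<noteq> 0 \<and> camera_block P Q x y *v v = 0"
    then obtain v :: "real^6" where v: "v \<noteq> 0" "camera_block P Q x y *v v = 0" by blast
    define z :: "real^4" where "z = vector [v$1, v$2, v$3, v$4]"
    have "vector [z$1, z$2, z$3, z$4, v$5, v$6] = v"
      by (simp add: z_def vec_eq_iff forall_6 vector_4)
    moreover have "\<not> (z = 0 \<and> v$5 = 0 \<and> v$6 = 0)"
      using v(1) by (auto simp add: z_def vec_eq_iff forall_6 forall_4 vector_4)
    ultimately show "\<exists>z t r. \<not> (z = 0 \<and> t = 0 \<and> r = 0) \<and> P *v z + t *\<^sub>R x = 0 \<and> Q *v z + r *\<^sub>R y = 0"
      using eq v(2) by metis
  next
    assume "\<exists>z t r. \<not> (z = 0 \<and> t = 0 \<and> r = 0) \<and> P *v z + t *\<^sub>R x = 0 \<and> Q *v z + r *\<^sub>R y = 0"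
    then obtain z t r where z: "\<not> (z = 0 \<and> t = 0 \<and> r = 0)" "P *v z + t *\<^sub>R x = 0" "Q *v z + r *\<^sub>R y = 0"
      by blast
    have "vector [z$1, z$2, z$3, z$4, t, r] \<noteq> (0 :: real^6)"
      using z(1) by (auto simp add: vec_eq_iff forall_6 forall_4)
    then show "\<exists>v. v \<noteq> 0 \<and> camera_block P Q x y *v v = 0" using eq z by blast
  qed
  finally show ?thesis .
qed

lemma psi_incidence: "(P *v z) \<bullet> (psi P Q *v (Q *v z)) = 0"
proof -
  have "det (camera_block P Q (P *v z) (Q *v z)) = 0"
    unfolding camera_block_singular_iff
    \<comment> \<open>The kernel vector is \<open>z\<close> with both scalars -1; it is nonzero even
      for \<open>z = 0\<close>.\<close>
    by (intro exI[of _ z] exI[of _ "-1"]) simp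
  then show ?thesis by (simp add: det_camera_block)
qed

text \<open>A common center makes every block matrix singular, whatever \<open>x\<close> and
  \<open>y\<close>. Contrapositively, a nonzero fundamental matrix separates the centers.\<close>

lemma psi_common_center:
  assumes "z \<noteq> 0" "P *v z = 0" "Q *v z = 0"
  shows "psi P Q = 0"
proof (rule psi_unique, intro allI)
  fix x y
  have "det (camera_block P Q x y) = 0"
    unfolding camera_block_singular_iff
    by (intro exI[of _ z] exI[of _ 0]) (simp add: assms)
  then show "det (camera_block P Q x y) = x \<bullet> (0 *v y)" by simp
qed

text \<open>A quadratic form that vanishes identically has a skew bilinear form. With a center as
  one argument, this shows that the other camera maps that center to an epipole.\<close>

lemma incidence_polarized:
  assumes "\<And>z. (P *v z) \<bullet> (G *v (Q *v z)) = 0"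
  shows "(P *v z) \<bullet> (G *v (Q *v w)) = - ((P *v w) \<bullet> (G *v (Q *v z)))"
  using assms[of "z + w"] assms[of z] assms[of w]
  by (simp add: matrix_vector_right_distrib inner_add_left inner_add_right)

lemma camera_surj:
  assumes "camera P"
  obtains z where "P *v z = v"
proof -
  have "surj ((*v) P)"
    using assms full_rank_surjective[of P] by (simp add: camera_def)
  then show ?thesis using that by (metis surj_def)
qed

text \<open>The kernel is the orthogonal complement of the row space, of dimension 4 - 3 =
  1.\<close>

lemma camera_center:
  assumes "camera P"
  obtains c where "c \<noteq> 0" "P *v c = 0" "\<And>z. P *v z = 0 \<Longrightarrow> \<exists>t. z = t *\<^sub>R c"
proof -
  let ?K = "{z \<in> UNIV. \<forall>r\<in>span (rows P). orthogonal r z}"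
  have rows: "rows P = range (($) P)"
    by (auto simp: rows_def row_def vec_lambda_eta)
  have K: "z \<in> ?K \<longleftrightarrow> P *v z = 0" for z
  proof -
    have "P *v z = 0 \<longleftrightarrow> (\<forall>r\<in>rows P. orthogonal r z)"
      by (auto simp: vec_eq_iff[of "P *v z"] matrix_vector_mul_component rows orthogonal_def)
    also have "\<dots> \<longleftrightarrow> z \<in> ?K"
      by (auto intro: span_base) (metis orthogonal_commute orthogonal_to_span)
    finally show ?thesis by simp
  qed
  have "dim ?K + dim (span (rows P)) = dim (UNIV :: (real^4) set)"
    by (rule dim_subspace_orthogonal_to_vectors) auto
  then have d: "dim ?K = 1"
    using assms by (simp add: camera_def row_rank_def)
  obtain B where B: "B \<subseteq> ?K" "independent B" "?K \<subseteq> span B" "card B = dim ?K"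
    using basis_exists by blast
  then obtain c where c: "B = {c}" using d card_1_singletonE by metis
  show ?thesis
  proof
    show "c \<noteq> 0" using B(2) c by (auto simp: dependent_zero)
    show "P *v c = 0" using B(1) c K by auto
    fix z assume "P *v z = 0"
    then have "z \<in> span {c}" using K B(3) c by auto
    then show "\<exists>t. z = t *\<^sub>R c" by (auto simp: span_singleton)
  qed
qed

text \<open>Meant for two distinct centers \<open>c\<close> and \<open>d\<close>. Independence is
  recorded only for the coordinates along \<open>u\<close> and \<open>v\<close>, the ones on which
  the incidence form depends.\<close>

lemma basis_extending_pair:
  fixes c d :: "real^4"
  assumes "c \<noteq> 0" "\<And>t. d \<noteq> t *\<^sub>R c"
  obtains u v where
    "\<And>z. \<exists>a b p q. z = a *\<^sub>R c + b *\<^sub>R d + p *\<^sub>R u + q *\<^sub>R v"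
    "\<And>a b p q. a *\<^sub>R c + b *\<^sub>R d + p *\<^sub>R u + q *\<^sub>R v = 0 \<Longrightarrow> p = 0 \<and> q = 0"
proof -
  have cd: "c \<noteq> d" using assms(2)[of 1] by auto
  have ind: "independent {d, c}"
    using assms by (subst independent_insert) (auto simp: span_singleton cd)
  obtain B where B: "{d, c} \<subseteq> B" "independent B" "UNIV \<subseteq> span B"
    using maximal_independent_subset_extend[of "{d,c}" UNIV] ind by auto
  have card: "card B = 4"
    using basis_card_eq_dim[of B UNIV] B by simp
  have "finite B" using card card.infinite by fastforce
  then have "card (B - {d, c}) = 2"
    using B(1) card cd by (simp add: card_Diff_subset)
  then obtain u v where uv: "B - {d, c} = {u, v}" "u \<noteq> v" by (meson card_2_iff)
  have Beq: "B = {c, d, u, v}" using B(1) uv(1) by auto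
  have un: "u \<noteq> c" "u \<noteq> d" "v \<noteq> c" "v \<noteq> d" using uv by auto
  show ?thesis
  proof
    fix z
    have "z \<in> span {c, d, u, v}" using B(3) Beq by auto
    then obtain a b p q where "z - a *\<^sub>R c - b *\<^sub>R d - p *\<^sub>R u - q *\<^sub>R v = 0"
      by (auto simp: span_breakdown_eq)
    then have "z = a *\<^sub>R c + b *\<^sub>R d + p *\<^sub>R u + q *\<^sub>R v" by (simp add: algebra_simps)
    then show "\<exists>a b p q. z = a *\<^sub>R c + b *\<^sub>R d + p *\<^sub>R u + q *\<^sub>R v" by blast
  next
    fix a b p q
    assume z: "a *\<^sub>R c + b *\<^sub>R d + p *\<^sub>R u + q *\<^sub>R v = 0"
    define f where "f x = (if x = c then a else if x = d then b else if x = u then p else q)" for x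
    have "(\<Sum>x\<in>B. f x *\<^sub>R x) = 0"
      using z cd un uv(2) by (simp add: Beq f_def add.assoc)
    then have "f u = 0" "f v = 0"
      using independentD[OF B(2) \<open>finite B\<close> subset_refl, of f] Beq by auto
    then show "p = 0 \<and> q = 0" using un uv(2) by (auto simp: f_def)
  qed
qed

text \<open>Pulled back to R^4, incidence is an alternating form whose radical contains both
  centers. It descends to a two-dimensional quotient, where alternating forms are unique up to a
  factor.\<close>

lemma psi_unique_up_to_scale:
  assumes P: "camera P" and Q: "camera Q"
    and centers: "\<And>z. P *v z = 0 \<Longrightarrow> Q *v z = 0 \<Longrightarrow> z = 0"
    and G: "\<And>z. (P *v z) \<bullet> (G *v (Q *v z)) = 0" "G \<noteq> 0"
  shows "same_up_to_scale G (psi P Q)"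
proof -
  obtain c where c: "c \<noteq> 0" "P *v c = 0" "\<And>z. P *v z = 0 \<Longrightarrow> \<exists>t. z = t *\<^sub>R c"
    using camera_center[OF P] by blast
  obtain d where d: "d \<noteq> 0" "Q *v d = 0" "\<And>z. Q *v z = 0 \<Longrightarrow> \<exists>t. z = t *\<^sub>R d"
    using camera_center[OF Q] by blast
  have "d \<noteq> t *\<^sub>R c" for t
    using centers[of d] c(2) d(1,2) by (auto simp: matrix_vector_mult_scaleR)
  then obtain u v where
    spn: "\<And>z. \<exists>a b p q. z = a *\<^sub>R c + b *\<^sub>R d + p *\<^sub>R u + q *\<^sub>R v" and
    ind: "\<And>a b p q. a *\<^sub>R c + b *\<^sub>R d + p *\<^sub>R u + q *\<^sub>R v = 0 \<Longrightarrow> p = 0 \<and> q = 0"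
    using basis_extending_pair[OF c(1)] by metis
  \<comment> \<open>The factor \<open>k\<close> is chosen before \<open>H\<close>, so that the same
    one serves \<open>G\<close> and \<open>psi P Q\<close>. It is the determinant of the
    \<open>u\<close>, \<open>v\<close> coordinates of preimages of \<open>x\<close> and
    \<open>y\<close>.\<close>
  have form: "\<exists>k. \<forall>H. (\<forall>z. (P *v z) \<bullet> (H *v (Q *v z)) = 0) \<longrightarrow>
      x \<bullet> (H *v y) = k * ((P *v u) \<bullet> (H *v (Q *v v)))" for x y
  proof -
    obtain z w where zw: "P *v z = x" "Q *v w = y"
      using camera_surj[OF P] camera_surj[OF Q] by metis
    obtain a b p q where z: "z = a *\<^sub>R c + b *\<^sub>R d + p *\<^sub>R u + q *\<^sub>R v" using spn by blast
    obtain a' b' p' q' where w: "w = a' *\<^sub>R c + b' *\<^sub>R d + p' *\<^sub>R u + q' *\<^sub>R v" using spn by blast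
    have "x \<bullet> (H *v y) = (p * q' - q * p') * ((P *v u) \<bullet> (H *v (Q *v v)))"
      if H: "\<forall>z. (P *v z) \<bullet> (H *v (Q *v z)) = 0" for H
    proof -
      note pol = incidence_polarized[of P H Q, OF H[rule_format]]
      have 1: "(P *v r) \<bullet> (H *v (Q *v c)) = 0" for r using pol[of r c] c(2) by simp
      have 2: "(P *v d) \<bullet> (H *v (Q *v r)) = 0" for r using pol[of d r] d(2) by simp
      have 3: "(P *v u) \<bullet> (H *v (Q *v u)) = 0" "(P *v v) \<bullet> (H *v (Q *v v)) = 0" using H by auto
      have "x \<bullet> (H *v y) = (P *v (p *\<^sub>R u + q *\<^sub>R v)) \<bullet> (H *v (Q *v (p' *\<^sub>R u + q' *\<^sub>R v)))"
        unfolding zw[symmetric] z w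
        by (simp add: matrix_vector_right_distrib matrix_vector_mult_scaleR inner_add_left
            inner_add_right 1 2 c(2) d(2))
      also have "\<dots> = (p * q' - q * p') * ((P *v u) \<bullet> (H *v (Q *v v)))"
        by (simp add: matrix_vector_right_distrib matrix_vector_mult_scaleR inner_add_left
            inner_add_right 3 pol[of v u] algebra_simps)
      finally show ?thesis .
    qed
    then show ?thesis by blast
  qed
  \<comment> \<open>Otherwise the block matrix has a kernel vector; comparing coordinates along
    \<open>u\<close> and \<open>v\<close> forces both scalars to vanish, and \<open>z\<close> would
    be a common center.\<close>
  have nz: "(P *v u) \<bullet> (psi P Q *v (Q *v v)) \<noteq> 0"
  proof
    assume "(P *v u) \<bullet> (psi P Q *v (Q *v v)) = 0"
    then obtain z t r where ztr: "\<not> (z = 0 \<and> t = 0 \<and> r = 0)"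
      "P *v z + t *\<^sub>R (P *v u) = 0" "Q *v z + r *\<^sub>R (Q *v v) = 0"
      using camera_block_singular_iff[of P Q] by (auto simp: det_camera_block)
    have "P *v (z + t *\<^sub>R u) = 0" "Q *v (z + r *\<^sub>R v) = 0"
      using ztr by (simp_all add: matrix_vector_right_distrib matrix_vector_mult_scaleR)
    then obtain a b where ab: "z + t *\<^sub>R u = a *\<^sub>R c" "z + r *\<^sub>R v = b *\<^sub>R d"
      using c(3) d(3) by blast
    have "a *\<^sub>R c + (- b) *\<^sub>R d + (- t) *\<^sub>R u + r *\<^sub>R v = (z + t *\<^sub>R u) - (z + r *\<^sub>R v) - t *\<^sub>R u + r *\<^sub>R v"
      unfolding ab by (simp add: algebra_simps)
    also have "\<dots> = 0" by (simp add: algebra_simps)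
    finally have "t = 0" "r = 0" using ind by fastforce+
    then show False using ztr centers by simp
  qed
  let ?k = "((P *v u) \<bullet> (G *v (Q *v v))) / ((P *v u) \<bullet> (psi P Q *v (Q *v v)))"
  have "x \<bullet> (G *v y) = x \<bullet> ((?k *\<^sub>R psi P Q) *v y)" for x y
  proof -
    obtain k where "\<And>H. (\<forall>z. (P *v z) \<bullet> (H *v (Q *v z)) = 0) \<Longrightarrow>
      x \<bullet> (H *v y) = k * ((P *v u) \<bullet> (H *v (Q *v v)))"
      using form[of x y] by blast
    from this[of G] this[of "psi P Q"] show ?thesis
      using G(1) psi_incidence[of P _ Q] nz by (simp add: scaleR_matrix_vector_assoc[symmetric])
  qed
  then have eq: "G = ?k *\<^sub>R psi P Q" by (metis matrix_eq vector_eq_ldot)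
  moreover have "?k \<noteq> 0" using eq G(2) by (metis scaleR_zero_left)
  ultimately show ?thesis unfolding same_up_to_scale_def by blast
qed

lemma inner_transpose_mult: "u \<bullet> (transpose A *v v) = v \<bullet> (A *v u)" for A :: "real^'n^'m"
  by (metis dot_lmul_matrix inner_commute transpose_matrix_vector)

section \<open>Coordinates in three-space\<close>

lemma basis_3:
  fixes a b p :: "real^3"
  assumes ab: "\<And>\<alpha> \<beta>. \<alpha> *\<^sub>R a + \<beta> *\<^sub>R b = 0 \<Longrightarrow> \<alpha> = 0 \<and> \<beta> = 0"
    and p: "\<And>\<alpha> \<beta>. p \<noteq> \<alpha> *\<^sub>R a + \<beta> *\<^sub>R b"
  shows "\<exists>\<alpha> \<beta> s. v = \<alpha> *\<^sub>R a + \<beta> *\<^sub>R b + s *\<^sub>R p"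
proof -
  have b: "b \<noteq> 0" using ab[of 0 1] by auto
  have ba: "a \<notin> span {b}"
  proof
    assume "a \<in> span {b}"
    then obtain t where "a = t *\<^sub>R b" by (auto simp: span_singleton)
    then show False using ab[of 1 "- t"] by simp
  qed
  have pab: "p \<notin> span {a, b}"
  proof
    assume "p \<in> span {a, b}"
    then obtain \<alpha> \<beta> where "p - \<alpha> *\<^sub>R a - \<beta> *\<^sub>R b = 0" by (auto simp: span_breakdown_eq)
    then have "p = \<alpha> *\<^sub>R a + \<beta> *\<^sub>R b" by (simp add: algebra_simps)
    then show False using p by simp
  qed
  have ne: "a \<noteq> b" "p \<noteq> a" "p \<noteq> b" using ba pab by (auto simp: span_base)
  have "independent {p, a, b}"
    using b ba pab ne by (simp add: independent_insert)
  moreover have "card {p, a, b} = 3" using ne by simp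
  ultimately have "span {p, a, b} = (UNIV :: (real^3) set)"
    using card_ge_dim_independent[of "{p,a,b}" UNIV] by (simp add: top.extremum_unique)
  then have "v \<in> span {p, a, b}" by simp
  then obtain s \<alpha> \<beta> where "v - s *\<^sub>R p - \<alpha> *\<^sub>R a - \<beta> *\<^sub>R b = 0" by (auto simp: span_breakdown_eq)
  then have "v = \<alpha> *\<^sub>R a + \<beta> *\<^sub>R b + s *\<^sub>R p" by (simp add: algebra_simps)
  then show ?thesis by blast
qed

text \<open>A normal vector in the plane of \<open>a\<close> and \<open>b\<close> would be
  orthogonal to itself.\<close>

lemma basis_3_normal:
  fixes a b n :: "real^3"
  assumes ab: "\<And>\<alpha> \<beta>. \<alpha> *\<^sub>R a + \<beta> *\<^sub>R b = 0 \<Longrightarrow> \<alpha> = 0 \<and> \<beta> = 0"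
    and n: "n \<noteq> 0" "n \<bullet> a = 0" "n \<bullet> b = 0"
  shows "\<exists>\<alpha> \<beta> s. v = \<alpha> *\<^sub>R a + \<beta> *\<^sub>R b + s *\<^sub>R n"
proof (rule basis_3[OF ab])
  fix \<alpha> \<beta>
  have "n \<bullet> n \<noteq> n \<bullet> (\<alpha> *\<^sub>R a + \<beta> *\<^sub>R b)" using n by (simp add: inner_add_right)
  then show "n \<noteq> \<alpha> *\<^sub>R a + \<beta> *\<^sub>R b" by metis
qed

text \<open>Removes the determinant from the problem: nonzero \<open>F i j\<close> excludes common
  centers, and distinct centers let incidence determine \<open>psi\<close> up to scale.
  Transposition extends the condition from \<open>i < j\<close> to all ordered pairs.\<close>

lemma compatible_iff_incidence:
  assumes nonzero: "\<forall>i\<in>{1..n}. \<forall>j\<in>{1..n}. i \<noteq> j \<longrightarrow> F i j \<noteq> 0"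
    and transposed: "\<forall>i\<in>{1..n}. \<forall>j\<in>{1..n}. i \<noteq> j \<longrightarrow> F j i = transpose (F i j)"
  shows "compatible n F \<longleftrightarrow> (\<exists>P. (\<forall>i\<in>{1..n}. camera (P i)) \<and>
      (\<forall>i\<in>{1..n}. \<forall>j\<in>{1..n}. i \<noteq> j \<longrightarrow>
        (\<forall>z. P i *v z = 0 \<longrightarrow> P j *v z = 0 \<longrightarrow> z = 0) \<and>
        (\<forall>z. (P i *v z) \<bullet> (F i j *v (P j *v z)) = 0)))"
    (is "_ \<longleftrightarrow> (\<exists>P. ?cam P \<and> ?inc P)")
proof
  assume "compatible n F"
  then obtain P where P: "?cam P"
    "\<And>i j. i \<in> {1..n} \<Longrightarrow> j \<in> {1..n} \<Longrightarrow> i < j \<Longrightarrow> same_up_to_scale (F i j) (psi (P i) (P j))"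
    unfolding compatible_def by blast
  have lt: "(\<forall>z. P i *v z = 0 \<longrightarrow> P j *v z = 0 \<longrightarrow> z = 0) \<and> (\<forall>z. (P i *v z) \<bullet> (F i j *v (P j *v z)) = 0)"
    if ij: "i \<in> {1..n}" "j \<in> {1..n}" "i < j" for i j
  proof -
    obtain c where c: "c \<noteq> 0" "F i j = c *\<^sub>R psi (P i) (P j)"
      using P(2)[OF ij] by (auto simp: same_up_to_scale_def)
    have "psi (P i) (P j) \<noteq> 0" using c nonzero ij by fastforce
    then show ?thesis
      using psi_common_center[of _ "P i" "P j"] psi_incidence[of "P i" _ "P j"]
      by (auto simp: c(2) scaleR_matrix_vector_assoc[symmetric])
  qed
  have "?inc P"
  proof (intro ballI impI)
    fix i j assume ij: "i \<in> {1..n}" "j \<in> {1..n}" "i \<noteq> j"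
    show "(\<forall>z. P i *v z = 0 \<longrightarrow> P j *v z = 0 \<longrightarrow> z = 0) \<and> (\<forall>z. (P i *v z) \<bullet> (F i j *v (P j *v z)) = 0)"
    proof (cases "i < j")
      case True then show ?thesis using lt ij by blast
    next
      case False
      moreover have "F i j = transpose (F j i)" using ij transposed by metis
      ultimately show ?thesis using lt[of j i] ij by (auto simp: inner_transpose_mult simp del: transpose_matrix_vector)
    qed
  qed
  then show "\<exists>P. ?cam P \<and> ?inc P" using P(1) by blast
next
  assume "\<exists>P. ?cam P \<and> ?inc P"
  then obtain P where P: "?cam P" "?inc P" by blast
  have "same_up_to_scale (F i j) (psi (P i) (P j))"
    if "i \<in> {1..n}" "j \<in> {1..n}" "i < j" for i j
  proof (rule psi_unique_up_to_scale)
    show "z = 0" if "P i *v z = 0" "P j *v z = 0" for z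
      using P(2) \<open>i \<in> {1..n}\<close> \<open>j \<in> {1..n}\<close> \<open>i < j\<close> that by (metis less_irrefl)
  qed (use that P nonzero in auto)
  then show "compatible n F" using P(1) unfolding compatible_def by blast
qed

section \<open>Coplanar centers in normal form\<close>

definition views :: "nat set" where
  "views = {1, 2, 3, 4}"

lemma views_atLeastAtMost: "{1..4} = views"
  by (auto simp: views_def)

lemma in_views [simp]: "1 \<in> views" "Suc 0 \<in> views" "2 \<in> views" "3 \<in> views" "4 \<in> views"
  by (simp_all add: views_def)

lemma index_complement:
  assumes "i \<in> views"
  obtains j k l where "distinct [i, j, k, l]" "views = {i, j, k, l}"
proof -
  have "i = 1 \<or> i = 2 \<or> i = 3 \<or> i = 4" using assms by (auto simp: views_def)
  then show ?thesis
    using that[of 2 3 4] that[of 1 3 4] that[of 1 2 4] that[of 1 2 3] by (auto simp: views_def insert_commute)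
qed

lemma index_complement_2:
  assumes "i \<in> views" "j \<in> views" "i \<noteq> j"
  obtains k l where "distinct [i, j, k, l]" "views = {i, j, k, l}"
proof -
  obtain a b c where d: "distinct [i, a, b, c]" "views = {i, a, b, c}"
    using index_complement[OF assms(1)] by metis
  moreover have "j = a \<or> j = b \<or> j = c" using assms(2,3) unfolding d(2) by auto
  ultimately show ?thesis
    using that[of b c] that[of a c] that[of a b] by (auto simp: insert_commute)
qed

text \<open>
  Setting \<open>g i i = 0\<close> (there is no such epipole) matches \<open>P i *v c i = 0\<close> for the center \<open>c i\<close>.
\<close>

locale coplanar_views =
  fixes F :: "nat \<Rightarrow> nat \<Rightarrow> real^3^3" and g :: "nat \<Rightarrow> nat \<Rightarrow> real^3"
  assumes transposed: "\<lbrakk>i \<in> views; j \<in> views; i \<noteq> j\<rbrakk> \<Longrightarrow> F j i = transpose (F i j)"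
    and kernel: "\<lbrakk>i \<in> views; j \<in> views; i \<noteq> j; F i j *v v = 0\<rbrakk> \<Longrightarrow> \<exists>t. v = t *\<^sub>R g j i"
    and kernel_g: "\<lbrakk>i \<in> views; j \<in> views; i \<noteq> j\<rbrakk> \<Longrightarrow> F i j *v g j i = 0"
    and g_self: "g i i = 0"
    and g_sum: "i \<in> views \<Longrightarrow> (\<Sum>j\<in>views. g i j) = 0"
    and g_indep: "\<lbrakk>i \<in> views; j \<in> views; k \<in> views; distinct [i, j, k];
       a *\<^sub>R g i j + b *\<^sub>R g i k = 0\<rbrakk> \<Longrightarrow> a = 0 \<and> b = 0"
begin

lemma bil_transposed:
  "\<lbrakk>i \<in> views; j \<in> views; i \<noteq> j\<rbrakk> \<Longrightarrow> bil u (F j i) v = bil v (F i j) u"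
  unfolding bil_def by (metis transposed inner_transpose_mult)

lemma g_sum_3:
  assumes "distinct [i, j, k, l]" "views = {i, j, k, l}"
  shows "g i j + g i k + g i l = 0"
  using g_sum[of i] assms(1) unfolding assms(2) by (simp add: g_self add.assoc)

text \<open>Two of the three epipoles are independent and all three sum to zero, so the relations
  among them are the multiples of that one. The coefficient at \<open>i\<close> is free because
  \<open>g i i = 0\<close>.\<close>

lemma g_relation:
  assumes "i \<in> views" "(\<Sum>j\<in>views. a j *\<^sub>R g i j) = 0"
  shows "\<exists>\<kappa>. \<forall>j\<in>views-{i}. a j = \<kappa>"
proof -
  obtain j k l where d: "distinct [i, j, k, l]" "views = {i, j, k, l}"
    using index_complement[OF assms(1)] by metis
  have gl: "g i l = - g i j - g i k" using g_sum_3[OF d] by (metis add.commute add_diff_cancel_right' diff_0 diff_diff_eq)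
  have "a j *\<^sub>R g i j + a k *\<^sub>R g i k + a l *\<^sub>R g i l = 0"
    using assms(2) d(1) unfolding d(2) by (simp add: g_self add.assoc)
  then have "(a j - a l) *\<^sub>R g i j + (a k - a l) *\<^sub>R g i k = 0"
    by (simp add: gl algebra_simps)
  then have "a j = a l" "a k = a l"
    using g_indep[of i j k "a j - a l" "a k - a l"] d(1) unfolding d(2) by auto
  then show ?thesis unfolding d(2) by auto
qed

lemma g_neq_0:
  assumes "i \<in> views" "j \<in> views" "i \<noteq> j"
  shows "g i j \<noteq> 0"
proof -
  obtain k l where d: "distinct [i, j, k, l]" "views = {i, j, k, l}"
    using index_complement_2[OF assms] by metis
  then show ?thesis using g_indep[of i j k 1 0] unfolding d(2) by auto
qed

lemma F_g_neq_0:
  assumes "i \<in> views" "j \<in> views" "k \<in> views" "distinct [i, j, k]"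
  shows "F i j *v g j k \<noteq> 0"
proof
  assume "F i j *v g j k = 0"
  then obtain t where "g j k = t *\<^sub>R g j i" using kernel assms by fastforce
  then have "1 *\<^sub>R g j k + (- t) *\<^sub>R g j i = 0" by simp
  then show False using g_indep[of j k i 1 "-t"] assms by auto
qed

lemma F_neq_0:
  assumes "i \<in> views" "j \<in> views" "i \<noteq> j"
  shows "F i j \<noteq> 0"
proof -
  obtain k l where d: "distinct [i, j, k, l]" "views = {i, j, k, l}"
    using index_complement_2[OF assms] by metis
  then show ?thesis using F_g_neq_0[of i j k] unfolding d(2) by auto
qed

section \<open>Cameras in normal form, in both directions\<close>

lemma compatible_iff:
  "compatible 4 F \<longleftrightarrow> (\<exists>P. (\<forall>i\<in>views. camera (P i)) \<and>
      (\<forall>i\<in>views. \<forall>j\<in>views. i \<noteq> j \<longrightarrow>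
        (\<forall>z. P i *v z = 0 \<longrightarrow> P j *v z = 0 \<longrightarrow> z = 0) \<and>
        (\<forall>z. (P i *v z) \<bullet> (F i j *v (P j *v z)) = 0)))"
  by (rule compatible_iff_incidence[of 4 F, unfolded views_atLeastAtMost])
    (use F_neq_0 transposed in blast)+

text \<open>Each camera sees the other centers in its epipoles, up to factors. The linear dependence
  of the four centers, seen in one view, must be that of its epipoles, so rescaling the centers
  leaves one factor per view, which the scale of the camera absorbs. The last clause puts
  \<open>w\<close> off the plane of the centers.\<close>

lemma compatible_normal_form:
  assumes "compatible 4 F"
  shows "\<exists>(P :: nat \<Rightarrow> real^4^3) c w.
    (\<forall>i\<in>views. \<forall>j\<in>views. P i *v c j = g i j) \<and>
    (\<forall>i\<in>views. \<forall>j\<in>views. i \<noteq> j \<longrightarrow> (\<forall>z. (P i *v z) \<bullet> (F i j *v (P j *v z)) = 0)) \<and>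
    (\<forall>i\<in>views. \<forall>a. P i *v w \<noteq> (\<Sum>j\<in>views. a j *\<^sub>R g i j))"
proof -
  note I = views_def
  obtain P where cam: "\<And>i. i \<in> views \<Longrightarrow> camera (P i)" and
    sep: "\<And>i j z. i \<in> views \<Longrightarrow> j \<in> views \<Longrightarrow> i \<noteq> j \<Longrightarrow> P i *v z = 0 \<Longrightarrow> P j *v z = 0 \<Longrightarrow> z = 0" and
    inc: "\<And>i j z. i \<in> views \<Longrightarrow> j \<in> views \<Longrightarrow> i \<noteq> j \<Longrightarrow> (P i *v z) \<bullet> (F i j *v (P j *v z)) = 0"
    using assms unfolding compatible_iff by metis
  have "\<forall>i\<in>views. \<exists>c. c \<noteq> 0 \<and> P i *v c = 0 \<and> (\<forall>z. P i *v z = 0 \<longrightarrow> (\<exists>t. z = t *\<^sub>R c))"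
    using camera_center[OF cam] by metis
  then obtain c where c: "\<And>i. i \<in> views \<Longrightarrow> c i \<noteq> 0" "\<And>i. i \<in> views \<Longrightarrow> P i *v c i = 0"
    "\<And>i z. i \<in> views \<Longrightarrow> P i *v z = 0 \<Longrightarrow> \<exists>t. z = t *\<^sub>R c i"
    by metis
  \<comment> \<open>By skewness \<open>F i j\<close> kills the image of \<open>c i\<close> under
    \<open>P j\<close>; the image is nonzero because the centers differ.\<close>
  have "\<exists>t. t \<noteq> 0 \<and> P j *v c i = t *\<^sub>R g j i" if ij: "i \<in> views" "j \<in> views" "i \<noteq> j" for i j
  proof -
    have "x \<bullet> (F i j *v (P j *v c i)) = 0" for x
    proof -
      obtain z where "P i *v z = x" using camera_surj[OF cam[OF ij(1)]] by metis
      then show ?thesis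
        using incidence_polarized[of "P i" "F i j" "P j" z "c i"] inc[OF ij] c(2)[OF ij(1)] by simp
    qed
    then have "F i j *v (P j *v c i) = 0" by (metis inner_eq_zero_iff)
    then obtain t where t: "P j *v c i = t *\<^sub>R g j i" using kernel ij by blast
    moreover have "P j *v c i \<noteq> 0" using sep[OF ij] c(1,2)[OF ij(1)] by blast
    ultimately show ?thesis by auto
  qed
  then obtain L where L: "\<And>i j. i \<in> views \<Longrightarrow> j \<in> views \<Longrightarrow> i \<noteq> j \<Longrightarrow> L i j \<noteq> 0 \<and> P j *v c i = L i j *\<^sub>R g j i"
    by metis
  \<comment> \<open>With these factors view 1 sends the three centers to its three epipoles, whose
    sum is zero; hence the combination is a multiple of \<open>c 1\<close>.\<close>
  have "P 1 *v ((1 / L 2 1) *\<^sub>R c 2 + (1 / L 3 1) *\<^sub>R c 3 + (1 / L 4 1) *\<^sub>R c 4) = g 1 2 + g 1 3 + g 1 4"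
    using L[of _ 1] by (simp add: matrix_vector_right_distrib matrix_vector_mult_scaleR)
  also have "\<dots> = 0" by (rule g_sum_3) (auto simp: views_def)
  finally obtain f where f: "(1 / L 2 1) *\<^sub>R c 2 + (1 / L 3 1) *\<^sub>R c 3 + (1 / L 4 1) *\<^sub>R c 4 = f *\<^sub>R c 1"
    using c(3)[of 1] by auto
  \<comment> \<open>The value \<open>- f\<close> at index 1 makes the sum of the \<open>d i\<close>
    vanish. That it is nonzero emerges only in \<open>c_d\<close>.\<close>
  define \<delta> where "\<delta> i = (if i = 1 then - f else 1 / L i 1)" for i
  define d where "d i = \<delta> i *\<^sub>R c i" for i
  have \<delta>: "\<delta> i \<noteq> 0" if "i \<in> views" "i \<noteq> 1" for i
    using L[of i 1] that by (simp add: \<delta>_def)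
  have "(\<Sum>j\<in>views. d j) =
      (- f) *\<^sub>R c 1 + ((1 / L 2 1) *\<^sub>R c 2 + (1 / L 3 1) *\<^sub>R c 3 + (1 / L 4 1) *\<^sub>R c 4)"
    by (simp add: I d_def \<delta>_def add.assoc)
  then have sumd: "(\<Sum>j\<in>views. d j) = 0" by (simp only: f) simp
  \<comment> \<open>Mapped by \<open>P i\<close>, the relation among the \<open>d j\<close> is a
    relation among the epipoles of view \<open>i\<close>, so its coefficients agree. An index other
    than 1 and \<open>i\<close> shows that their common value is nonzero.\<close>
  have "\<exists>\<kappa>. \<kappa> \<noteq> 0 \<and> (\<forall>j\<in>views. P i *v d j = \<kappa> *\<^sub>R g i j)" if i: "i \<in> views" for i
  proof -
    have Pd: "P i *v d j = (\<delta> j * L j i) *\<^sub>R g i j" if "j \<in> views" for j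
      using that i c(2) L[of j i] by (cases "i = j") (simp_all add: d_def g_self matrix_vector_mult_scaleR)
    have "(\<Sum>j\<in>views. (\<delta> j * L j i) *\<^sub>R g i j) = P i *v (\<Sum>j\<in>views. d j)"
      by (simp add: Pd linear_sum[OF matrix_vector_mul_linear])
    also have "\<dots> = 0" by (simp only: sumd matrix_vector_mult_0_right)
    finally obtain \<kappa> where \<kappa>: "\<forall>j\<in>views-{i}. \<delta> j * L j i = \<kappa>"
      using g_relation[OF i, of "\<lambda>j. \<delta> j * L j i"] by auto
    have "\<exists>j. j \<in> views \<and> j \<noteq> 1 \<and> j \<noteq> i"
      by (rule exI[of _ "if i = 2 then 3 else 2"]) (auto simp: views_def)
    then obtain j where "j \<in> views" "j \<noteq> 1" "j \<noteq> i" by blast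
    then have "\<delta> j * L j i = \<kappa>" "\<delta> j \<noteq> 0" "L j i \<noteq> 0" using \<kappa> \<delta> L i by blast+
    then have "\<kappa> \<noteq> 0" by auto
    moreover have "P i *v d j = \<kappa> *\<^sub>R g i j" if j: "j \<in> views" for j
    proof (cases "j = i")
      case False
      then show ?thesis using j \<kappa> Pd[OF j] by (metis DiffI singletonD)
    qed (use Pd[OF j] in \<open>simp add: g_self\<close>)
    ultimately show ?thesis by blast
  qed
  then have "\<forall>i\<in>views. \<exists>\<kappa>. \<kappa> \<noteq> 0 \<and> (\<forall>j\<in>views. P i *v d j = \<kappa> *\<^sub>R g i j)"
    by blast
  then obtain K where "\<forall>i\<in>views. K i \<noteq> 0 \<and> (\<forall>j\<in>views. P i *v d j = K i *\<^sub>R g i j)"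
    using bchoice[of views "\<lambda>i \<kappa>. \<kappa> \<noteq> 0 \<and> (\<forall>j\<in>views. P i *v d j = \<kappa> *\<^sub>R g i j)"] by blast
  then have K: "\<And>i. i \<in> views \<Longrightarrow> K i \<noteq> 0"
    "\<And>i j. i \<in> views \<Longrightarrow> j \<in> views \<Longrightarrow> P i *v d j = K i *\<^sub>R g i j"
    by blast+
  have c_d: "c i = (1 / \<delta> i) *\<^sub>R d i" if i: "i \<in> views" for i
  proof -
    have "\<exists>j. j \<in> views \<and> j \<noteq> i" by (rule exI[of _ "if i = 2 then 3 else 2"]) (auto simp: views_def)
    then obtain j where j: "j \<in> views" "j \<noteq> i" by blast
    then have "P j *v d i \<noteq> 0" using K i g_neq_0 by simp
    then have "\<delta> i \<noteq> 0" by (auto simp: d_def)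
    then show ?thesis by (simp add: d_def)
  qed
  \<comment> \<open>Three vectors cannot span R^4. As \<open>d 4\<close> is minus their sum,
    \<open>w\<close> avoids the span of all four centers.\<close>
  have "span {d 1, d 2, d 3} \<noteq> UNIV"
  proof
    assume "span {d 1, d 2, d 3} = UNIV"
    then have "dim (span {d 1, d 2, d 3}) = 4" by (simp del: dim_span)
    then have "dim {d 1, d 2, d 3} = 4" by simp
    moreover have "dim {d 1, d 2, d 3} \<le> card {d 1, d 2, d 3}" by (rule dim_le_card') simp
    moreover have "card {d 1, d 2, d 3} \<le> 3"
      by (simp add: card_insert_if)
    ultimately show False by simp
  qed
  then obtain w where w: "w \<notin> span {d 1, d 2, d 3}" by blast
  have "d 1 + d 2 + d 3 + d 4 = 0" using sumd by (simp add: I add.assoc)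
  then have "d 4 = - (d 1 + d 2 + d 3)" by (metis add.inverse_inverse neg_eq_iff_add_eq_0)
  then have "d 4 \<in> span {d 1, d 2, d 3}"
    by (simp add: span_neg span_diff span_base)
  then have ds: "d i \<in> span {d 1, d 2, d 3}" if "i \<in> views" for i
    using that by (auto simp: I span_base)
  define P' where "P' i = (1 / K i) *\<^sub>R P i" for i
  have P': "P' i *v z = (1 / K i) *\<^sub>R (P i *v z)" for i z
    by (simp add: P'_def scaleR_matrix_vector_assoc)
  show ?thesis
  proof (intro exI[of _ P'] exI[of _ d] exI[of _ w] conjI ballI impI allI)
    fix i j assume "i \<in> views" "j \<in> views"
    then show "P' i *v d j = g i j" using K by (simp add: P')
  next
    fix i j z assume "i \<in> views" "j \<in> views" "i \<noteq> j"
    then show "(P' i *v z) \<bullet> (F i j *v (P' j *v z)) = 0" using inc by (simp add: P' matrix_vector_mult_scaleR)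
  next
    fix i a assume i: "i \<in> views"
    show "P' i *v w \<noteq> (\<Sum>j\<in>views. a j *\<^sub>R g i j)"
    proof
      \<comment> \<open>An image on the line of epipoles would place \<open>w\<close>, up to a
        multiple of the center of view \<open>i\<close>, in the span of the \<open>d j\<close>,
        which contains that center too.\<close>
      assume eq: "P' i *v w = (\<Sum>j\<in>views. a j *\<^sub>R g i j)"
      have "P i *v w = K i *\<^sub>R (P' i *v w)" using K i by (simp add: P')
      also have "\<dots> = P i *v (\<Sum>j\<in>views. a j *\<^sub>R d j)"
        unfolding eq using K(2)[OF i]
        by (simp add: linear_sum[OF matrix_vector_mul_linear] matrix_vector_mult_scaleR
            scaleR_sum_right mult.commute)
      finally have "P i *v (w - (\<Sum>j\<in>views. a j *\<^sub>R d j)) = 0" by (simp add: matrix_vector_mult_diff_distrib)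
      then obtain t where "w - (\<Sum>j\<in>views. a j *\<^sub>R d j) = t *\<^sub>R c i" using c(3) i by blast
      then have "w = (\<Sum>j\<in>views. a j *\<^sub>R d j) + t *\<^sub>R c i" by (simp add: diff_eq_eq add.commute)
      also have "t *\<^sub>R c i = (t / \<delta> i) *\<^sub>R d i" by (subst c_d[OF i]) simp
      finally have "w \<in> span {d 1, d 2, d 3}"
        using ds i by (auto intro!: span_add span_sum span_scale)
      then show False using w by blast
    qed
  qed
qed

text \<open>Two of the epipoles together with \<open>p\<close> form a basis. Summing over all views
  avoids singling out a pair, at the price of coefficients that are not unique.\<close>

lemma view_basis:
  assumes "i \<in> views" and p: "\<And>a. p \<noteq> (\<Sum>m\<in>views. a m *\<^sub>R g i m)"
  shows "\<exists>a s. v = (\<Sum>m\<in>views. a m *\<^sub>R g i m) + s *\<^sub>R p"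
proof -
  obtain j k l where d: "distinct [i, j, k, l]" "views = {i, j, k, l}"
    using index_complement[OF assms(1)] by metis
  define c where "c \<alpha> \<beta> m = (if m = j then \<alpha> else if m = k then \<beta> else 0)" for \<alpha> \<beta> :: real and m
  have c: "(\<Sum>m\<in>views. c \<alpha> \<beta> m *\<^sub>R g i m) = \<alpha> *\<^sub>R g i j + \<beta> *\<^sub>R g i k" for \<alpha> \<beta>
    using d(1) unfolding d(2) by (simp add: c_def)
  have "\<exists>\<alpha> \<beta> s. v = \<alpha> *\<^sub>R g i j + \<beta> *\<^sub>R g i k + s *\<^sub>R p"
  proof (rule basis_3)
    show "p \<noteq> \<alpha> *\<^sub>R g i j + \<beta> *\<^sub>R g i k" for \<alpha> \<beta> using p c by metis
  next
    fix \<alpha> \<beta> assume "\<alpha> *\<^sub>R g i j + \<beta> *\<^sub>R g i k = 0"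
    then show "\<alpha> = 0 \<and> \<beta> = 0" using g_indep[of i j k \<alpha> \<beta>] d(1) unfolding d(2) by auto
  qed
  then show ?thesis using c by metis
qed

text \<open>The first three unit vectors of R^4 serve as centers 1 to 3, minus their sum as center
  4, and the fourth unit vector as \<open>w\<close>, with image \<open>p i\<close>. The assumptions
  \<open>plane\<close>, \<open>skew\<close> and \<open>diag\<close> make the coefficients of
  \<open>z$4\<close> to the powers 0, 1 and 2 in the incidence form vanish.\<close>

lemma compatible_if_normal_form:
  assumes plane: "\<And>i j a b. \<lbrakk>i \<in> views; j \<in> views; i \<noteq> j; a \<in> views; b \<in> views\<rbrakk> \<Longrightarrow> bil (g i a) (F i j) (g j b) = 0"
    and skew: "\<And>i j k. \<lbrakk>i \<in> views; j \<in> views; i \<noteq> j; k \<in> views\<rbrakk> \<Longrightarrow>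
       bil (g i k) (F i j) (p j) + bil (p i) (F i j) (g j k) = 0"
    and diag: "\<And>i j. \<lbrakk>i \<in> views; j \<in> views; i \<noteq> j\<rbrakk> \<Longrightarrow> bil (p i) (F i j) (p j) = 0"
    and off: "\<And>i a. i \<in> views \<Longrightarrow> p i \<noteq> (\<Sum>j\<in>views. a j *\<^sub>R g i j)"
  shows "compatible 4 F"
proof -
  note I = views_def
  define P :: "nat \<Rightarrow> real^4^3" where
    "P i = matrix (\<lambda>z. z$1 *\<^sub>R g i 1 + z$2 *\<^sub>R g i 2 + z$3 *\<^sub>R g i 3 + z$4 *\<^sub>R p i)" for i
  have P: "P i *v z = z$1 *\<^sub>R g i 1 + z$2 *\<^sub>R g i 2 + z$3 *\<^sub>R g i 3 + z$4 *\<^sub>R p i" for i z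
    by (simp add: P_def matrix_def matrix_vector_mult_def vec_eq_iff sum_4 axis_def algebra_simps)
  \<comment> \<open>Index 4 gets the coordinate 0, which allows sums over all of
    \<open>views\<close>.\<close>
  define \<zeta> :: "real^4 \<Rightarrow> nat \<Rightarrow> real" where
    "\<zeta> z m = (if m = 1 then z$1 else if m = 2 then z$2 else if m = 3 then z$3 else 0)" for z m
  have P\<zeta>: "P i *v z = (\<Sum>m\<in>views. \<zeta> z m *\<^sub>R g i m) + z$4 *\<^sub>R p i" for i z
    by (simp add: P I \<zeta>_def add.assoc)
  have "camera (P i)" if i: "i \<in> views" for i
  proof -
    have "\<exists>z. P i *v z = v" for v
    proof -
      obtain a s where v: "v = (\<Sum>m\<in>views. a m *\<^sub>R g i m) + s *\<^sub>R p i"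
        using view_basis[OF i off[OF i]] by blast
      \<comment> \<open>The epipoles in a view sum to zero, so subtracting \<open>a 4\<close> from
        every coefficient changes nothing and clears the fourth.\<close>
      define z :: "real^4" where "z = vector [a 1 - a 4, a 2 - a 4, a 3 - a 4, s]"
      have "P i *v z = (\<Sum>m\<in>views. (a m - a 4) *\<^sub>R g i m) + s *\<^sub>R p i"
        by (simp add: P I z_def vector_4 add.assoc)
      also have "(\<Sum>m\<in>views. (a m - a 4) *\<^sub>R g i m) = (\<Sum>m\<in>views. a m *\<^sub>R g i m)"
        using g_sum[OF i] by (simp add: scaleR_diff_left sum_subtractf scaleR_sum_right[symmetric])
      finally show ?thesis using v by metis
    qed
    then show ?thesis
      using full_rank_surjective[of "P i"] by (auto simp: camera_def surj_def) metis
  qed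
  moreover have "z = 0" if ij: "i \<in> views" "j \<in> views" "i \<noteq> j" and z: "P i *v z = 0" "P j *v z = 0" for i j z
  proof -
    have z4: "z$4 = 0"
    proof (rule ccontr)
      assume "z$4 \<noteq> 0"
      then have "p i = (- 1 / z$4) *\<^sub>R ((\<Sum>m\<in>views. \<zeta> z m *\<^sub>R g i m) - P i *v z)"
        by (simp add: P\<zeta>)
      then have "p i = (\<Sum>m\<in>views. (- \<zeta> z m / z$4) *\<^sub>R g i m)"
        by (simp add: z scaleR_sum_right sum_negf[symmetric])
      then show False using off[OF ij(1), of "\<lambda>m. - \<zeta> z m / z$4"] by blast
    qed
    obtain \<kappa> where \<kappa>: "\<forall>m\<in>views-{i}. \<zeta> z m = \<kappa>"
      using g_relation[OF ij(1), of "\<zeta> z"] z(1) z4 by (auto simp: P\<zeta>)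
    obtain \<kappa>' where \<kappa>': "\<forall>m\<in>views-{j}. \<zeta> z m = \<kappa>'"
      using g_relation[OF ij(2), of "\<zeta> z"] z(2) z4 by (auto simp: P\<zeta>)
    obtain k l where d: "distinct [i, j, k, l]" "views = {i, j, k, l}"
      using index_complement_2[OF ij] by metis
    have "\<kappa> = \<kappa>'" using \<kappa> \<kappa>' d(1) unfolding d(2) by auto
    then have "\<zeta> z m = \<kappa>" if "m \<in> views" for m
      using \<kappa> \<kappa>' that ij(3) by (cases "m = i") auto
    \<comment> \<open>All coefficients agree, and the one at index 4 is 0 by the choice of
      \<open>\<zeta>\<close>.\<close>
    from this[of 1] this[of 2] this[of 3] this[of 4] have "z$1 = 0" "z$2 = 0" "z$3 = 0"
      by (simp_all add: \<zeta>_def)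
    with z4 show "z = 0" by (simp add: vec_eq_iff forall_4)
  qed
  moreover have "(P i *v z) \<bullet> (F i j *v (P j *v z)) = 0" if ij: "i \<in> views" "j \<in> views" "i \<noteq> j" for i j z
  proof -
    let ?A = "\<Sum>m\<in>views. \<zeta> z m *\<^sub>R g i m" and ?B = "\<Sum>m\<in>views. \<zeta> z m *\<^sub>R g j m"
    have "?A \<bullet> (F i j *v ?B) = 0"
      using plane[OF ij, unfolded bil_def]
      by (simp add: inner_sum_left inner_sum_right linear_sum[OF matrix_vector_mul_linear] matrix_vector_mult_scaleR)
    moreover have "?A \<bullet> (F i j *v p j) + p i \<bullet> (F i j *v ?B) =
        (\<Sum>m\<in>views. \<zeta> z m * (bil (g i m) (F i j) (p j) + bil (p i) (F i j) (g j m)))"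
      by (simp add: bil_def inner_sum_left inner_sum_right linear_sum[OF matrix_vector_mul_linear]
          matrix_vector_mult_scaleR sum.distrib distrib_left)
    then have "?A \<bullet> (F i j *v p j) + p i \<bullet> (F i j *v ?B) = 0" using ij by (simp add: skew)
    moreover have "(A + t *\<^sub>R p i) \<bullet> (F i j *v (B + t *\<^sub>R p j)) =
        A \<bullet> (F i j *v B) + t * (A \<bullet> (F i j *v p j) + p i \<bullet> (F i j *v B)) + t * t * (p i \<bullet> (F i j *v p j))"
      for A B t
      by (simp add: inner_add_left inner_add_right matrix_vector_right_distrib matrix_vector_mult_scaleR algebra_simps)
    ultimately show ?thesis
      using diag[OF ij] by (simp add: P\<zeta> bil_def)
  qed
  ultimately show ?thesis unfolding compatible_iff by blast
qed

end

section \<open>Equations for the scales and offsets\<close>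

text \<open>
  Below, \<open>m i j k\<close> and \<open>W i j\<close> stand for \<open>bil (x i) (F i j) (g j k)\<close> and \<open>bil (x i) (F i j) (x j)\<close>.
  The two predicates are the parts of the incidence condition that are linear and quadratic in the
  coordinate along \<open>w\<close>.
\<close>

definition skew_scaling :: "(nat \<Rightarrow> nat \<Rightarrow> nat \<Rightarrow> real) \<Rightarrow> (nat \<Rightarrow> real) \<Rightarrow> bool" where
  "skew_scaling m s \<longleftrightarrow> (\<forall>i\<in>views. s i \<noteq> 0) \<and>
     (\<forall>i\<in>views. \<forall>j\<in>views. \<forall>k\<in>views. i \<noteq> j \<longrightarrow> s j * m j i k + s i * m i j k = 0)"

definition offset_solution ::
    "(nat \<Rightarrow> nat \<Rightarrow> nat \<Rightarrow> real) \<Rightarrow> (nat \<Rightarrow> nat \<Rightarrow> real) \<Rightarrow> (nat \<Rightarrow> real) \<Rightarrow> (nat \<Rightarrow> nat \<Rightarrow> real) \<Rightarrow> bool" where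
  "offset_solution m W s y \<longleftrightarrow>
     (\<forall>i\<in>views. \<forall>j\<in>views. i < j \<longrightarrow> s j * W i j + (\<Sum>k\<in>views. (y j k - y i k) * m i j k) = 0)"

text \<open>Condition (2) freed of nonzero factors: around the triangle \<open>j\<close>,
  \<open>k\<close>, \<open>l\<close> the ratios of \<open>m p q i\<close> to \<open>m q p i\<close>
  have product -1.\<close>

definition cyclic :: "(nat \<Rightarrow> nat \<Rightarrow> nat \<Rightarrow> real) \<Rightarrow> nat \<Rightarrow> nat \<Rightarrow> nat \<Rightarrow> nat \<Rightarrow> bool" where
  "cyclic m i j k l \<longleftrightarrow> m j l i * m k j i * m l k i + m l j i * m j k i * m k l i = 0"

text \<open>The left-hand side of (3) for the scaled epipoles \<open>g\<close>. A factor such as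
  \<open>bil (g 2 3) (F 2 4) (x 4)\<close> is read as \<open>m 4 2 3\<close> through the
  transpose.\<close>

definition edge_expression :: "(nat \<Rightarrow> nat \<Rightarrow> nat \<Rightarrow> real) \<Rightarrow> (nat \<Rightarrow> nat \<Rightarrow> real) \<Rightarrow> real" where
  "edge_expression m W =
    - (m 4 2 3 / m 2 4 1) * (W 1 2 / m 1 2 3)
    + (m 4 3 2 / m 3 4 1) * (W 1 3 / m 1 3 2)
    + (m 4 3 1 / m 3 4 1) * (W 2 3 / m 2 3 1)
    - (m 4 3 2 / m 4 1 2) * (m 3 1 2 / m 1 3 2) * (W 1 4 / m 3 4 1)
    + W 2 4 / m 2 4 1 - W 3 4 / m 3 4 1"

text \<open>Multiplying the three scaling equations of the triangle \<open>j\<close>,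
  \<open>k\<close>, \<open>l\<close> yields the common factor \<open>s j * s k * s l\<close>; three
  sign changes give the sign in \<open>cyclic\<close>.\<close>

lemma skew_scaling_cyclic:
  assumes "skew_scaling m s" "i \<in> views" "j \<in> views" "k \<in> views" "l \<in> views" "distinct [j, k, l]"
  shows "cyclic m i j k l"
proof -
  have s: "s j \<noteq> 0" "s k \<noteq> 0" "s l \<noteq> 0" using assms by (auto simp: skew_scaling_def)
  have "s l * m l j i + s j * m j l i = 0" "s j * m j k i + s k * m k j i = 0" "s k * m k l i + s l * m l k i = 0"
    using assms by (auto simp: skew_scaling_def)
  then have "s l * m l j i = - (s j * m j l i)" "s j * m j k i = - (s k * m k j i)" "s k * m k l i = - (s l * m l k i)"
    by simp_all
  then have "(s l * m l j i) * (s j * m j k i) * (s k * m k l i) = - ((s j * m j l i) * (s k * m k j i) * (s l * m l k i))"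
    by simp
  then have "(s j * s k * s l) * (m j l i * m k j i * m l k i + m l j i * m j k i * m k l i) = 0"
    by (simp add: algebra_simps)
  then show ?thesis using s by (simp add: cyclic_def)
qed

text \<open>The geometry behind the scalar system: \<open>m_1\<close> holds because epipoles span
  kernels, \<open>m_2\<close> because \<open>g j j = 0\<close>, \<open>m_3\<close> because the
  epipoles of a view sum to zero.\<close>

locale edge_coefficients =
  fixes m :: "nat \<Rightarrow> nat \<Rightarrow> nat \<Rightarrow> real"
  assumes m_1: "\<lbrakk>i \<in> views; j \<in> views; i \<noteq> j\<rbrakk> \<Longrightarrow> m i j i = 0"
    and m_2: "\<lbrakk>i \<in> views; j \<in> views; i \<noteq> j\<rbrakk> \<Longrightarrow> m i j j = 0"
    and m_3: "\<lbrakk>distinct [i, j, k, l]; views = {i, j, k, l}\<rbrakk> \<Longrightarrow> m i j l = - m i j k"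
    and m_nz: "\<lbrakk>i \<in> views; j \<in> views; k \<in> views; distinct [i, j, k]\<rbrakk> \<Longrightarrow> m i j k \<noteq> 0"
begin

text \<open>Normalizes the third index to the least one available, leaving one coefficient per
  ordered pair.\<close>

lemma m_values:
  "m 1 2 4 = - m 1 2 3" "m 2 1 4 = - m 2 1 3" "m 1 3 4 = - m 1 3 2" "m 3 1 4 = - m 3 1 2"
  "m 1 4 3 = - m 1 4 2" "m 4 1 3 = - m 4 1 2" "m 2 3 4 = - m 2 3 1" "m 3 2 4 = - m 3 2 1"
  "m 2 4 3 = - m 2 4 1" "m 4 2 3 = - m 4 2 1" "m 3 4 2 = - m 3 4 1" "m 4 3 2 = - m 4 3 1"
  by (rule m_3; auto simp: views_def)+

lemma m_zeros:
  assumes "i \<in> {1, 2, 3, 4}" "j \<in> {1, 2, 3, 4}" "i \<noteq> j"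
  shows "m i j i = 0" "m i j j = 0"
  using assms m_1[of i j] m_2[of i j] by (auto simp: views_def)

lemma m_nonzeros:
  "m 1 2 3 \<noteq> 0" "m 2 1 3 \<noteq> 0" "m 1 3 2 \<noteq> 0" "m 3 1 2 \<noteq> 0" "m 1 4 2 \<noteq> 0" "m 4 1 2 \<noteq> 0"
  "m 2 3 1 \<noteq> 0" "m 3 2 1 \<noteq> 0" "m 2 4 1 \<noteq> 0" "m 4 2 1 \<noteq> 0" "m 3 4 1 \<noteq> 0" "m 4 3 1 \<noteq> 0"
  by (rule m_nz; simp)+

text \<open>For a fixed pair, two choices of \<open>k\<close> give 0 = 0 and the other two agree up
  to sign; the equation is also symmetric in the pair. So each of the six edges contributes
  one.\<close>

lemma skew_scaling_iff:
  "skew_scaling m s \<longleftrightarrow> s 1 \<noteq> 0 \<and> s 2 \<noteq> 0 \<and> s 3 \<noteq> 0 \<and> s 4 \<noteq> 0 \<and>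
     s 2 * m 2 1 3 + s 1 * m 1 2 3 = 0 \<and> s 3 * m 3 1 2 + s 1 * m 1 3 2 = 0 \<and>
     s 4 * m 4 1 2 + s 1 * m 1 4 2 = 0 \<and> s 3 * m 3 2 1 + s 2 * m 2 3 1 = 0 \<and>
     s 4 * m 4 2 1 + s 2 * m 2 4 1 = 0 \<and> s 4 * m 4 3 1 + s 3 * m 3 4 1 = 0"
  unfolding skew_scaling_def views_def using m_zeros
  by (simp add: m_values add.commute del: One_nat_def) linarith

lemma offset_solution_iff:
  "offset_solution m W s y \<longleftrightarrow>
     s 2 * W 1 2 + ((y 2 3 - y 1 3) - (y 2 4 - y 1 4)) * m 1 2 3 = 0 \<and>
     s 3 * W 1 3 + ((y 3 2 - y 1 2) - (y 3 4 - y 1 4)) * m 1 3 2 = 0 \<and>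
     s 4 * W 1 4 + ((y 4 2 - y 1 2) - (y 4 3 - y 1 3)) * m 1 4 2 = 0 \<and>
     s 3 * W 2 3 + ((y 3 1 - y 2 1) - (y 3 4 - y 2 4)) * m 2 3 1 = 0 \<and>
     s 4 * W 2 4 + ((y 4 1 - y 2 1) - (y 4 3 - y 2 3)) * m 2 4 1 = 0 \<and>
     s 4 * W 3 4 + ((y 4 1 - y 3 1) - (y 4 2 - y 3 2)) * m 3 4 1 = 0"
  unfolding offset_solution_def views_def using m_zeros
  by (simp add: m_values algebra_simps del: One_nat_def)

text \<open>The scaling equations turn the quotients of coefficients into quotients of scales. What
  remains is one signed term per edge, the constant term of its equation for \<open>y\<close> after
  division by the coefficient.\<close>

lemma edge_expression_eq:
  assumes "skew_scaling m s"
  shows "s 4 * edge_expression m W =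
    - (s 2 * W 1 2 / m 1 2 3 - s 3 * W 1 3 / m 1 3 2 + s 4 * W 1 4 / m 1 4 2 +
       s 3 * W 2 3 / m 2 3 1 - s 4 * W 2 4 / m 2 4 1 + s 4 * W 3 4 / m 3 4 1)"
proof -
  have s: "s 1 \<noteq> 0" "s 2 \<noteq> 0" "s 3 \<noteq> 0" "s 4 \<noteq> 0" and
    "s 4 * m 4 2 1 + s 2 * m 2 4 1 = 0" "s 4 * m 4 3 1 + s 3 * m 3 4 1 = 0"
    "s 4 * m 4 1 2 + s 1 * m 1 4 2 = 0" "s 3 * m 3 1 2 + s 1 * m 1 3 2 = 0"
    using assms unfolding skew_scaling_iff by blast+
  then have m: "m 4 2 1 = - (s 2 * m 2 4 1 / s 4)" "m 4 3 1 = - (s 3 * m 3 4 1 / s 4)"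
    "m 4 1 2 = - (s 1 * m 1 4 2 / s 4)" "m 3 1 2 = - (s 1 * m 1 3 2 / s 3)"
    by (simp_all add: nonzero_eq_divide_eq eq_neg_iff_add_eq_0 minus_divide_left mult.commute
        del: One_nat_def minus_divide_left[symmetric])
  have r: "m 4 2 3 / m 2 4 1 = s 2 / s 4" "m 4 3 2 / m 3 4 1 = s 3 / s 4" "m 4 3 1 / m 3 4 1 = - (s 3 / s 4)"
    using m_nonzeros by (simp_all add: m_values m del: One_nat_def)
  have "(m 4 3 2 / m 4 1 2) * (m 3 1 2 / m 1 3 2) * (W 1 4 / m 3 4 1) = W 1 4 / m 1 4 2"
    using m_nonzeros(3,5,9,11) s by (simp add: m_values m del: One_nat_def)
  moreover have "s 4 * (- (s 2 / s 4) * A + s 3 / s 4 * B + - (s 3 / s 4) * C - D + E - G) =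
      - (s 2 * A - s 3 * B + s 4 * D + s 3 * C - s 4 * E + s 4 * G)" for A B C D E G
    using s(4) by (simp add: algebra_simps)
  ultimately show ?thesis
    unfolding edge_expression_def r by (simp only: times_divide_eq_right[symmetric])
qed

text \<open>With \<open>s 1 = 1\<close> the edges at view 1 determine the other scales. Each
  remaining edge closes a triangle with view 1, and the cyclic condition of that triangle yields its
  equation.\<close>

lemma ex_skew_scaling:
  assumes "cyclic m 2 1 3 4" "cyclic m 3 1 2 4" "cyclic m 4 1 2 3"
  shows "\<exists>s. skew_scaling m s"
proof -
  define s where "s i = (if i = 2 then - m 1 2 3 / m 2 1 3 else if i = 3 then - m 1 3 2 / m 3 1 2
    else if i = 4 then - m 1 4 2 / m 4 1 2 else 1)" for i :: nat
  have "skew_scaling m s"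
    unfolding skew_scaling_iff using m_nonzeros assms
    by (simp add: s_def cyclic_def m_values field_simps add_eq_0_iff del: One_nat_def)
  then show ?thesis by blast
qed

text \<open>Division by its coefficient turns each edge equation into a second difference of
  \<open>y\<close>. The signed sum of the six second differences cancels identically.\<close>

lemma offset_solution_imp_edge_expression:
  assumes "skew_scaling m s" "offset_solution m W s y"
  shows "edge_expression m W = 0"
proof -
  let ?d = "\<lambda>i j k l. (y i k - y j k) - (y i l - y j l)"
  have h: "a / c = - d" if "a + d * c = 0" "c \<noteq> 0" for a c d :: real
    using that by (simp add: nonzero_divide_eq_eq)
  have w: "s 2 * W 1 2 / m 1 2 3 = - ?d 2 1 3 4" "s 3 * W 1 3 / m 1 3 2 = - ?d 3 1 2 4"
    "s 4 * W 1 4 / m 1 4 2 = - ?d 4 1 2 3" "s 3 * W 2 3 / m 2 3 1 = - ?d 3 2 1 4"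
    "s 4 * W 2 4 / m 2 4 1 = - ?d 4 2 1 3" "s 4 * W 3 4 / m 3 4 1 = - ?d 4 3 1 2"
    by (rule h; use assms(2) m_nonzeros in \<open>unfold offset_solution_iff, blast\<close>)+
  have "s 4 * edge_expression m W = 0"
    unfolding edge_expression_eq[OF assms(1)] w by (simp add: algebra_simps)
  then show ?thesis using assms(1) by (simp add: skew_scaling_iff)
qed

text \<open>
  Shifting all \<open>y i\<close> by the same vector, or one \<open>y i\<close> by a constant, changes nothing; this freedom
  permits the zero entries of the witness \<open>y\<close>.
\<close>

lemma ex_offset_solution:
  assumes s: "skew_scaling m s" and e: "edge_expression m W = 0"
  shows "\<exists>y. offset_solution m W s y"
proof -
  define w where "w i j k = s j * W i j / m i j k" for i j k
  have rel: "w 1 2 3 - w 1 3 2 + w 1 4 2 + w 2 3 1 - w 2 4 1 + w 3 4 1 = 0"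
    using edge_expression_eq[OF s, of W] e by (simp add: w_def)
  have w: "s 2 * W 1 2 = w 1 2 3 * m 1 2 3" "s 3 * W 1 3 = w 1 3 2 * m 1 3 2"
    "s 4 * W 1 4 = w 1 4 2 * m 1 4 2" "s 3 * W 2 3 = w 2 3 1 * m 2 3 1"
    "s 4 * W 2 4 = w 2 4 1 * m 2 4 1" "s 4 * W 3 4 = w 3 4 1 * m 3 4 1"
    using m_nonzeros by (simp_all add: w_def)
  define y where "y i k =
     (if i = 3 \<and> k = 1 then w 3 4 1
      else if i = 2 \<and> k = 3 then - w 2 4 1 else if i = 2 \<and> k = 4 then - w 2 3 1 - w 3 4 1
      else if i = 1 \<and> k = 3 then - w 1 4 2 else if i = 1 \<and> k = 4 then - w 1 3 2 else 0)" for i k :: nat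
  \<comment> \<open>The witness meets the equations of the other five edges by construction; the
    edge from 1 to 2 is where the relation enters.\<close>
  have w1: "w 1 2 3 = w 1 3 2 - w 1 4 2 - w 2 3 1 + w 2 4 1 - w 3 4 1" using rel by simp
  have "offset_solution m W s y"
    unfolding offset_solution_iff w w1 by (simp add: y_def algebra_simps del: One_nat_def)
  then show ?thesis by blast
qed

lemma solvable_iff:
  "(\<exists>s y. skew_scaling m s \<and> offset_solution m W s y) \<longleftrightarrow>
     cyclic m 1 2 3 4 \<and> cyclic m 2 1 3 4 \<and> cyclic m 3 1 2 4 \<and> cyclic m 4 1 2 3 \<and> edge_expression m W = 0"
proof
  assume "\<exists>s y. skew_scaling m s \<and> offset_solution m W s y"
  then show "cyclic m 1 2 3 4 \<and> cyclic m 2 1 3 4 \<and> cyclic m 3 1 2 4 \<and> cyclic m 4 1 2 3 \<and> edge_expression m W = 0"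
    using skew_scaling_cyclic offset_solution_imp_edge_expression by auto
next
  assume "cyclic m 1 2 3 4 \<and> cyclic m 2 1 3 4 \<and> cyclic m 3 1 2 4 \<and> cyclic m 4 1 2 3 \<and> edge_expression m W = 0"
  then show "\<exists>s y. skew_scaling m s \<and> offset_solution m W s y"
    using ex_skew_scaling ex_offset_solution by blast
qed

end

section \<open>Reduction of compatibility to the equations\<close>

context coplanar_views
begin

text \<open>The vanishing part of the noncollinear triple-wise condition, for scaled epipoles. The
  cases \<open>k = i\<close> and \<open>k = j\<close> hold by \<open>g_self\<close> and save side
  conditions.\<close>

definition coplanar :: bool where
  "coplanar \<longleftrightarrow> (\<forall>i\<in>views. \<forall>j\<in>views. \<forall>k\<in>views. i \<noteq> j \<longrightarrow> bil (g i k) (F i j) (g j k) = 0)"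

lemma bil_kernel:
  assumes "i \<in> views" "j \<in> views" "i \<noteq> j"
  shows "bil u (F i j) (g j i) = 0" "bil (g i j) (F i j) u = 0"
  using kernel_g[OF assms] kernel_g[of j i] bil_transposed[of j i "g i j" u] assms
  by (simp_all add: bil_def)

text \<open>The lines of epipoles of two views correspond. An epipole toward the other camera
  contributes nothing, and the remaining two in view \<open>j\<close> sum to minus that epipole, so
  the cases in \<open>coplanar\<close> give the mixed ones.\<close>

lemma bil_plane:
  assumes c: coplanar and ij: "i \<in> views" "j \<in> views" "i \<noteq> j" and ab: "a \<in> views" "b \<in> views"
  shows "bil (g i a) (F i j) (g j b) = 0"
proof -
  obtain k l where d: "distinct [i, j, k, l]" "views = {i, j, k, l}"
    using index_complement_2[OF ij] by metis
  have d': "distinct [j, i, k, l]" "views = {j, i, k, l}" using d by auto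
  have gj: "g j i + g j k + g j l = 0" by (rule g_sum_3[OF d'])
  have sum0: "bil u (F i j) (g j k) + bil u (F i j) (g j l) = 0" for u
  proof -
    have "bil u (F i j) (g j i) + bil u (F i j) (g j k) + bil u (F i j) (g j l) = 0"
      using arg_cong[OF gj, of "bil u (F i j)"] by (simp add: bil_def matrix_vector_right_distrib inner_add_right)
    then show ?thesis using bil_kernel[OF ij] by simp
  qed
  have "bil (g i k) (F i j) (g j k) = 0" "bil (g i l) (F i j) (g j l) = 0"
    using c ij d(1) unfolding coplanar_def d(2) by auto
  then have kl: "bil (g i p) (F i j) (g j q) = 0" if "p \<in> {k, l}" "q \<in> {k, l}" for p q
    using that sum0[of "g i p"] by auto
  have "bil (g i a) (F i j) (g j i) = 0" "bil (g i j) (F i j) (g j b) = 0" "bil (g i i) (F i j) (g j b) = 0"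
    "bil (g i a) (F i j) (g j j) = 0"
    using bil_kernel[OF ij] by (simp_all add: g_self bil_def)
  then show ?thesis using kl ab unfolding d(2) by auto
qed

text \<open>The center of camera \<open>k\<close> is a world point with images \<open>g i k\<close>
  and \<open>g j k\<close>, so these satisfy incidence.\<close>

lemma compatible_imp_coplanar:
  assumes "compatible 4 F"
  shows coplanar
proof -
  obtain P :: "nat \<Rightarrow> real^4^3" and c where
    P: "\<forall>i\<in>views. \<forall>j\<in>views. P i *v c j = g i j"
    "\<forall>i\<in>views. \<forall>j\<in>views. i \<noteq> j \<longrightarrow> (\<forall>z. (P i *v z) \<bullet> (F i j *v (P j *v z)) = 0)"
    using compatible_normal_form[OF assms] by blast
  have "g i k \<bullet> (F i j *v g j k) = 0" if "i \<in> views" "j \<in> views" "k \<in> views" "i \<noteq> j" for i j k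
    using P(2)[rule_format, of i j "c k"] P(1) that by simp
  then show ?thesis by (simp add: coplanar_def bil_def)
qed

end

text \<open>Here \<open>x i\<close> may be any normal vector of the line of epipoles. For the
  vectors \<open>x\<close> of the theorem, normality comes from \<open>bil_plane\<close>.\<close>

locale coplanar_views_normals = coplanar_views +
  fixes x :: "nat \<Rightarrow> real^3"
  assumes coplanar: coplanar
    and x_nz: "i \<in> views \<Longrightarrow> x i \<noteq> 0"
    and x_normal: "\<lbrakk>i \<in> views; j \<in> views\<rbrakk> \<Longrightarrow> x i \<bullet> g i j = 0"
begin

definition m :: "nat \<Rightarrow> nat \<Rightarrow> nat \<Rightarrow> real" where
  "m i j k = bil (x i) (F i j) (g j k)"

definition W :: "nat \<Rightarrow> nat \<Rightarrow> real" where
  "W i j = bil (x i) (F i j) (x j)"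

lemma x_off_line: "i \<in> views \<Longrightarrow> x i \<noteq> (\<Sum>j\<in>views. a j *\<^sub>R g i j)"
proof
  assume i: "i \<in> views" and "x i = (\<Sum>j\<in>views. a j *\<^sub>R g i j)"
  then have "x i \<bullet> x i = x i \<bullet> (\<Sum>j\<in>views. a j *\<^sub>R g i j)" by simp
  also have "\<dots> = 0" using i by (simp add: inner_sum_right x_normal)
  finally show False using x_nz[OF i] by simp
qed

text \<open>By \<open>bil_plane\<close> this vector is orthogonal to all epipoles of view
  \<open>i\<close>, hence a multiple of the normal; pairing with \<open>x i\<close> gives the
  factor. This is what expresses (2) through the \<open>m i j k\<close>.\<close>

lemma F_g_parallel_x:
  assumes ij: "i \<in> views" "j \<in> views" "i \<noteq> j" and k: "k \<in> views"
  shows "F i j *v g j k = (m i j k / (norm (x i))\<^sup>2) *\<^sub>R x i"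
proof -
  obtain a s where v: "F i j *v g j k = (\<Sum>m\<in>views. a m *\<^sub>R g i m) + s *\<^sub>R x i"
    using view_basis[OF ij(1) x_off_line[OF ij(1)]] by blast
  let ?A = "\<Sum>m\<in>views. a m *\<^sub>R g i m"
  have "g i n \<bullet> (F i j *v g j k) = 0" if "n \<in> views" for n
    using bil_plane[OF coplanar ij that k] by (simp add: bil_def)
  then have "?A \<bullet> (F i j *v g j k) = 0" by (simp add: inner_sum_left)
  moreover have xA: "x i \<bullet> ?A = 0" using ij by (simp add: inner_sum_right x_normal)
  ultimately have "?A \<bullet> ?A = 0"
    unfolding v by (simp add: inner_add_right inner_commute[of ?A "x i"])
  then have A: "?A = 0" by simp
  then have "m i j k = s * (norm (x i))\<^sup>2"
    unfolding m_def bil_def v by (simp add: power2_norm_eq_inner)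
  then show ?thesis unfolding v A using x_nz[OF ij(1)] by simp
qed

lemma m_neq_0:
  assumes "i \<in> views" "j \<in> views" "k \<in> views" "distinct [i, j, k]"
  shows "m i j k \<noteq> 0"
proof
  assume "m i j k = 0"
  then have "F i j *v g j k = 0" using F_g_parallel_x[of i j k] assms by simp
  then show False using F_g_neq_0[OF assms] by simp
qed

sublocale edge_coefficients m
proof
  show "m i j i = 0" if "i \<in> views" "j \<in> views" "i \<noteq> j" for i j
    using bil_kernel[OF that] by (simp add: m_def)
  show "m i j j = 0" for i j by (simp add: m_def g_self bil_def)
  show "m i j l = - m i j k" if d: "distinct [i, j, k, l]" "views = {i, j, k, l}" for i j k l
  proof -
    have ij: "i \<in> views" "j \<in> views" "i \<noteq> j" using d(1) unfolding d(2) by auto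
    have "g j i + g j k + g j l = 0" using d by (intro g_sum_3) auto
    then have "bil (x i) (F i j) (g j i) + m i j k + m i j l = 0"
      using arg_cong[of _ _ "bil (x i) (F i j)"]
      by (simp add: m_def bil_def matrix_vector_right_distrib[symmetric] inner_add_right[symmetric])
    then show ?thesis using bil_kernel[OF ij] by simp
  qed
qed (fact m_neq_0)

text \<open>Here \<open>p i\<close> is the image of \<open>w\<close>. Terms of degree two in
  \<open>y\<close> vanish by \<open>bil_plane\<close>, and the scaling equations trade
  \<open>m j i k\<close> for \<open>m i j k\<close>, which extracts the factor
  \<open>s i\<close>.\<close>

lemma incidence_coefficients:
  fixes y :: "nat \<Rightarrow> nat \<Rightarrow> real" and s :: "nat \<Rightarrow> real"
  defines "p i \<equiv> (\<Sum>m\<in>views. y i m *\<^sub>R g i m) + s i *\<^sub>R x i"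
  assumes ij: "i \<in> views" "j \<in> views" "i \<noteq> j"
  shows "k \<in> views \<Longrightarrow> bil (g i k) (F i j) (p j) + bil (p i) (F i j) (g j k) = s j * m j i k + s i * m i j k"
    and "skew_scaling m s \<Longrightarrow>
      bil (p i) (F i j) (p j) = s i * (s j * W i j + (\<Sum>k\<in>views. (y j k - y i k) * m i j k))"
proof -
  let ?A = "\<Sum>m\<in>views. y i m *\<^sub>R g i m" and ?B = "\<Sum>m\<in>views. y j m *\<^sub>R g j m"
  note lin = inner_add_left inner_add_right inner_sum_left inner_sum_right matrix_vector_right_distrib
    matrix_vector_mult_scaleR linear_sum[OF matrix_vector_mul_linear]
  have plane: "g i a \<bullet> (F i j *v g j b) = 0" if "a \<in> views" "b \<in> views" for a b
    using bil_plane[OF coplanar ij that] by (simp add: bil_def)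
  have gx: "g i k \<bullet> (F i j *v x j) = m j i k" for k
    using bil_transposed[OF ij, of "x j" "g i k"] by (simp add: m_def bil_def)
  have xg: "x i \<bullet> (F i j *v g j k) = m i j k" for k by (simp add: m_def bil_def)
  show "bil (g i k) (F i j) (p j) + bil (p i) (F i j) (g j k) = s j * m j i k + s i * m i j k"
    if "k \<in> views"
    using that plane by (simp add: bil_def p_def lin gx xg)
  assume s: "skew_scaling m s"
  have "?A \<bullet> (F i j *v ?B) = 0" by (simp add: lin plane)
  moreover have "s j * (?A \<bullet> (F i j *v x j)) = - (s i * (\<Sum>k\<in>views. y i k * m i j k))"
  proof -
    have "s j * (y i k * m j i k) + s i * (y i k * m i j k) = 0" if "k \<in> views" for k
    proof -
      have "y i k * (s j * m j i k + s i * m i j k) = 0"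
        using s ij that by (simp add: skew_scaling_def)
      then show ?thesis by (simp only: distrib_left mult.left_commute)
    qed
    then have "(\<Sum>k\<in>views. s j * (y i k * m j i k) + s i * (y i k * m i j k)) = 0" by simp
    then show ?thesis
      by (simp add: lin gx sum_distrib_left sum.distrib eq_neg_iff_add_eq_0)
  qed
  moreover have "x i \<bullet> (F i j *v ?B) = (\<Sum>k\<in>views. y j k * m i j k)" by (simp add: lin xg)
  moreover have "bil (p i) (F i j) (p j) = ?A \<bullet> (F i j *v ?B) + s j * (?A \<bullet> (F i j *v x j)) +
      s i * (x i \<bullet> (F i j *v ?B)) + s i * s j * W i j"
    unfolding p_def bil_def W_def
    by (simp only: inner_add_left inner_add_right matrix_vector_right_distrib matrix_vector_mult_scaleR
        inner_scaleR_left inner_scaleR_right) (simp add: algebra_simps)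
  ultimately show "bil (p i) (F i j) (p j) =
      s i * (s j * W i j + (\<Sum>k\<in>views. (y j k - y i k) * m i j k))"
    by (simp add: left_diff_distrib sum_subtractf algebra_simps)
qed

text \<open>The unknowns are coordinates of the image of \<open>w\<close> in each view:
  \<open>y i\<close> along the epipoles, \<open>s i\<close> along the normal. That \<open>w\<close>
  is off the plane of the centers means that the scales are nonzero.\<close>

lemma compatible_iff_solvable:
  "compatible 4 F \<longleftrightarrow> (\<exists>s y. skew_scaling m s \<and> offset_solution m W s y)"
proof
  assume "compatible 4 F"
  then obtain P :: "nat \<Rightarrow> real^4^3" and c w where
    P': "\<forall>i\<in>views. \<forall>j\<in>views. P i *v c j = g i j"
    "\<forall>i\<in>views. \<forall>j\<in>views. i \<noteq> j \<longrightarrow> (\<forall>z. (P i *v z) \<bullet> (F i j *v (P j *v z)) = 0)"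
    "\<forall>i\<in>views. \<forall>a. P i *v w \<noteq> (\<Sum>j\<in>views. a j *\<^sub>R g i j)"
    using compatible_normal_form by blast
  note P = P'[rule_format]
  have "\<forall>i\<in>views. \<exists>a s. P i *v w = (\<Sum>m\<in>views. a m *\<^sub>R g i m) + s *\<^sub>R x i"
    using view_basis[OF _ x_off_line] by blast
  then obtain y s where w: "\<And>i. i \<in> views \<Longrightarrow> P i *v w = (\<Sum>m\<in>views. y i m *\<^sub>R g i m) + s i *\<^sub>R x i"
    by metis
  have "s i \<noteq> 0" if "i \<in> views" for i
    using P(3)[OF that, of "y i"] w[OF that] by auto
  moreover have "s j * m j i k + s i * m i j k = 0"
    if ij: "i \<in> views" "j \<in> views" "i \<noteq> j" and k: "k \<in> views" for i j k
    using incidence_coefficients(1)[OF ij k, of y s] incidence_polarized[of "P i" "F i j" "P j" "c k" w]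
      P(1,2) ij k by (simp add: bil_def w)
  ultimately have s: "skew_scaling m s" by (simp add: skew_scaling_def)
  have "offset_solution m W s y"
    unfolding offset_solution_def
  proof (intro ballI impI)
    fix i j assume ij: "i \<in> views" "j \<in> views" "i < j"
    then have ne: "i \<noteq> j" by simp
    have "s i * (s j * W i j + (\<Sum>k\<in>views. (y j k - y i k) * m i j k)) = 0"
      using incidence_coefficients(2)[OF ij(1,2) ne s, of y] P(2)[OF ij(1,2) ne, of w] ij
      by (simp add: bil_def w)
    then show "s j * W i j + (\<Sum>k\<in>views. (y j k - y i k) * m i j k) = 0"
      using s ij by (simp add: skew_scaling_def)
  qed
  with s show "\<exists>s y. skew_scaling m s \<and> offset_solution m W s y" by blast
next
  assume "\<exists>s y. skew_scaling m s \<and> offset_solution m W s y"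
  then obtain s y where s: "skew_scaling m s" and y: "offset_solution m W s y" by blast
  define p where "p i = (\<Sum>m\<in>views. y i m *\<^sub>R g i m) + s i *\<^sub>R x i" for i
  have lt: "bil (p i) (F i j) (p j) = 0" if ij: "i \<in> views" "j \<in> views" "i < j" for i j
    using incidence_coefficients(2)[of i j s y] s y ij by (simp add: p_def offset_solution_def)
  show "compatible 4 F"
  proof (rule compatible_if_normal_form[of p])
    show "bil (g i a) (F i j) (g j b) = 0"
      if "i \<in> views" "j \<in> views" "i \<noteq> j" "a \<in> views" "b \<in> views" for i j a b
      using bil_plane[OF coplanar that] .
    show "bil (g i k) (F i j) (p j) + bil (p i) (F i j) (g j k) = 0"
      if "i \<in> views" "j \<in> views" "i \<noteq> j" "k \<in> views" for i j k
      using incidence_coefficients(1)[OF that, of y s] s that by (simp add: p_def skew_scaling_def)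
    show "bil (p i) (F i j) (p j) = 0" if "i \<in> views" "j \<in> views" "i \<noteq> j" for i j
    proof (cases "i < j")
      case False
      then show ?thesis using that lt[of j i] bil_transposed[of j i "p i" "p j"] by auto
    qed (use that lt in auto)
    show "p i \<noteq> (\<Sum>j\<in>views. a j *\<^sub>R g i j)" if i: "i \<in> views" for i a
    proof
      assume "p i = (\<Sum>j\<in>views. a j *\<^sub>R g i j)"
      then have "s i *\<^sub>R x i = (\<Sum>j\<in>views. (a j - y i j) *\<^sub>R g i j)"
        by (simp add: p_def scaleR_diff_left sum_subtractf eq_diff_eq add.commute)
      then have "x i = (1 / s i) *\<^sub>R (\<Sum>j\<in>views. (a j - y i j) *\<^sub>R g i j)"
        using s i by (metis (no_types, lifting) divide_self_if scaleR_one scaleR_scaleR skew_scaling_def times_divide_eq_left mult_1)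
      then have "x i = (\<Sum>j\<in>views. ((a j - y i j) / s i) *\<^sub>R g i j)"
        by (simp add: scaleR_sum_right)
      then show False using x_off_line[OF i, of "\<lambda>j. (a j - y i j) / s i"] by blast
    qed
  qed
qed

lemma compatible_iff_equations:
  "compatible 4 F \<longleftrightarrow>
     cyclic m 1 2 3 4 \<and> cyclic m 2 1 3 4 \<and> cyclic m 3 1 2 4 \<and> cyclic m 4 1 2 3 \<and> edge_expression m W = 0"
  unfolding compatible_iff_solvable by (rule solvable_iff)

end

section \<open>Arbitrary epipole representatives\<close>

lemma distinct_points_independent:
  assumes "u \<noteq> 0" "v \<noteq> 0" "\<not> same_up_to_scale u v" "\<alpha> *\<^sub>R u + \<beta> *\<^sub>R v = 0"
  shows "\<alpha> = 0 \<and> \<beta> = 0"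
proof (rule ccontr)
  assume "\<not> (\<alpha> = 0 \<and> \<beta> = 0)"
  then have ne: "\<alpha> \<noteq> 0" "\<beta> \<noteq> 0" using assms by auto
  have "\<alpha> *\<^sub>R u = (- \<beta>) *\<^sub>R v" using assms(4) by (simp add: eq_neg_iff_add_eq_0)
  then have "(1 / \<alpha>) *\<^sub>R \<alpha> *\<^sub>R u = (1 / \<alpha>) *\<^sub>R (- \<beta>) *\<^sub>R v" by simp
  then have "u = (- \<beta> / \<alpha>) *\<^sub>R v" using ne by simp
  moreover have "- \<beta> / \<alpha> \<noteq> 0" using ne by simp
  ultimately show False using assms(3) unfolding same_up_to_scale_def by blast
qed

text \<open>Orthogonality to \<open>l\<close> places \<open>w\<close> in the span of
  \<open>u\<close> and \<open>v\<close>; distinctness from each of them makes both coefficients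
  nonzero.\<close>

lemma collinear_points_relation:
  fixes u v w l :: "real^3"
  assumes nz: "u \<noteq> 0" "v \<noteq> 0" "w \<noteq> 0"
    and distinct: "\<not> same_up_to_scale u v" "\<not> same_up_to_scale w u" "\<not> same_up_to_scale w v"
    and l: "l \<noteq> 0" "l \<bullet> u = 0" "l \<bullet> v = 0" "l \<bullet> w = 0"
  shows "\<exists>\<alpha> \<beta>. \<alpha> \<noteq> 0 \<and> \<beta> \<noteq> 0 \<and> w = \<alpha> *\<^sub>R u + \<beta> *\<^sub>R v"
proof -
  obtain \<alpha> \<beta> s where w: "w = \<alpha> *\<^sub>R u + \<beta> *\<^sub>R v + s *\<^sub>R l"
    using basis_3_normal[OF distinct_points_independent[OF nz(1,2) distinct(1)] l(1-3)] by blast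
  have "l \<bullet> w = s * (l \<bullet> l)" using l by (simp add: w inner_add_right)
  then have "s = 0" using l by simp
  then have w: "w = \<alpha> *\<^sub>R u + \<beta> *\<^sub>R v" using w by simp
  moreover have "\<alpha> \<noteq> 0"
  proof
    assume "\<alpha> = 0"
    then have "w = \<beta> *\<^sub>R v" "\<beta> \<noteq> 0" using w nz by auto
    then show False using distinct(3) unfolding same_up_to_scale_def by blast
  qed
  moreover have "\<beta> \<noteq> 0"
  proof
    assume "\<beta> = 0"
    then have "w = \<alpha> *\<^sub>R u" "\<alpha> \<noteq> 0" using w nz by auto
    then show False using distinct(2) unfolding same_up_to_scale_def by blast
  qed
  ultimately show ?thesis by blast
qed

text \<open>The ordering \<open>j < k < l\<close> leaves one triple for each
  \<open>i\<close>.\<close>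

lemma ordered_partitions:
  "(\<forall>i j k l. {i, j, k, l} = {1, 2, 3, 4::nat} \<and> j < k \<and> k < l \<longrightarrow> Q i j k l) \<longleftrightarrow>
     Q 1 2 3 4 \<and> Q 2 1 3 4 \<and> Q 3 1 2 4 \<and> Q 4 1 2 3"
proof -
  have "{i, j, k, l} = {1, 2, 3, 4::nat} \<and> j < k \<and> k < l \<longleftrightarrow>
      (i, j, k, l) \<in> {(1, 2, 3, 4), (2, 1, 3, 4), (3, 1, 2, 4), (4, 1, 2, 3)}" (is "?L \<longleftrightarrow> ?R") for i j k l
  proof
    assume L: ?L
    then have "j \<in> {1, 2, 3, 4}" "l \<in> {1, 2, 3, 4}" "j < k" "k < l" by blast+
    then have "1 \<le> j \<and> j < k \<and> k < l \<and> l \<le> 4" by auto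
    then have "j = 1 \<and> k = 2 \<and> l = 3 \<or> j = 1 \<and> k = 2 \<and> l = 4 \<or> j = 1 \<and> k = 3 \<and> l = 4 \<or>
        j = 2 \<and> k = 3 \<and> l = 4"
      by arith
    then consider "j = 1" "k = 2" "l = 3" | "j = 1" "k = 2" "l = 4" | "j = 1" "k = 3" "l = 4" | "j = 2" "k = 3" "l = 4"
      by blast
    then show ?R
    proof cases
      case 1
      have "4 \<in> {i, j, k, l}" using L by blast
      then show ?thesis using 1 by simp
    next
      case 2
      have "3 \<in> {i, j, k, l}" using L by blast
      then show ?thesis using 2 by simp
    next
      case 3
      have "2 \<in> {i, j, k, l}" using L by blast
      then show ?thesis using 3 by simp
    next
      case 4
      have "1 \<in> {i, j, k, l}" using L by blast
      then show ?thesis using 4 by simp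
    qed
  qed auto
  then show ?thesis by simp blast
qed

theorem theorem3p10:
  fixes F :: "nat \<Rightarrow> nat \<Rightarrow> real^3^3"
    and e :: "nat \<Rightarrow> nat \<Rightarrow> real^3"
    and x :: "nat \<Rightarrow> real^3"
  assumes fundamental:
      "\<forall>i\<in>{1..4}. \<forall>j\<in>{1..4}. i < j \<longrightarrow> fundamental_matrix (F i j)"
    and transposed:
      "\<forall>i\<in>{1..4}. \<forall>j\<in>{1..4}. i < j \<longrightarrow> F j i = transpose (F i j)"
    and epipoles:
      "\<forall>i\<in>{1..4}. \<forall>j\<in>{1..4}. i \<noteq> j \<longrightarrow> is_epipole (F i j) (e j i)"
    and epipoles_distinct:
      "\<forall>i\<in>{1..4}. \<forall>j\<in>{1..4}-{i}. \<forall>k\<in>{1..4}-{i}. j \<noteq> k \<longrightarrow>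
         \<not> same_up_to_scale (e i j) (e i k)"
    and epipoles_on_line:
      "\<forall>i\<in>{1..4}. on_common_line {e i j | j. j \<in> {1..4} - {i}}"
    and x_def:
      "\<forall>i j k l. {i, j, k, l} = {1, 2, 3, 4} \<and> j < k \<and> k < l \<longrightarrow> x i = F i j *v e j l"
  shows "compatible 4 F \<longleftrightarrow>
    (\<forall>i\<in>{1..4}. \<forall>j\<in>{1..4}. \<forall>k\<in>{1..4}. i \<noteq> j \<and> i \<noteq> k \<and> j \<noteq> k \<longrightarrow> triplewise F e i j k) \<and>
    (\<forall>i j k l. {i, j, k, l} = {1, 2, 3, 4} \<and> j < k \<and> k < l \<longrightarrow>
       ((F j k *v e k i) \<bullet> (F j l *v e l i)) * ((F k j *v e j i) \<bullet> (F k l *v e l i)) *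
         ((F l j *v e j i) \<bullet> (F l k *v e k i)) +
       (norm (F l j *v e j i))\<^sup>2 * (norm (F j k *v e k i))\<^sup>2 * (norm (F k l *v e l i))\<^sup>2 = 0) \<and>
    - (bil (e 2 3) (F 2 4) (x 4) / bil (x 2) (F 2 4) (e 4 1)) *
        (bil (x 1) (F 1 2) (x 2) / bil (x 1) (F 1 2) (e 2 3))
    + (bil (e 3 2) (F 3 4) (x 4) / bil (x 3) (F 3 4) (e 4 1)) *
        (bil (x 1) (F 1 3) (x 3) / bil (x 1) (F 1 3) (e 3 2))
    + (bil (e 3 1) (F 3 4) (x 4) / bil (x 3) (F 3 4) (e 4 1)) *
        (bil (x 2) (F 2 3) (x 3) / bil (x 2) (F 2 3) (e 3 1))
    - (bil (e 3 2) (F 3 4) (x 4) / bil (e 1 2) (F 1 4) (x 4)) *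
        (bil (e 1 2) (F 1 3) (x 3) / bil (x 1) (F 1 3) (e 3 2)) *
        (bil (x 1) (F 1 4) (x 4) / bil (x 3) (F 3 4) (e 4 1))
    + bil (x 2) (F 2 4) (x 4) / bil (x 2) (F 2 4) (e 4 1)
    - bil (x 3) (F 3 4) (x 4) / bil (x 3) (F 3 4) (e 4 1) = 0"
    (is "_ \<longleftrightarrow> ?triples \<and> ?cycles \<and> ?edges = 0")
proof -
  note hyps = transposed[unfolded views_atLeastAtMost] epipoles[unfolded views_atLeastAtMost]
    epipoles_distinct[unfolded views_atLeastAtMost] epipoles_on_line[unfolded views_atLeastAtMost]
  have Ft: "F j i = transpose (F i j)" if "i \<in> views" "j \<in> views" "i \<noteq> j" for i j
    using hyps(1) that by (cases "i < j") (auto simp: not_less le_less)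
  have e_nz: "e i j \<noteq> 0" and e_ker: "\<And>v. F j i *v v = 0 \<longleftrightarrow> v \<in> span {e i j}"
    if "i \<in> views" "j \<in> views" "i \<noteq> j" for i j
    using hyps(2)[rule_format, of j i] that by (auto simp: is_epipole_def)
  have e_ne: "\<not> same_up_to_scale (e i j) (e i k)"
    if "i \<in> views" "j \<in> views" "k \<in> views" "distinct [i, j, k]" for i j k
    using hyps(3) that by auto
  have e_line: "\<exists>l. l \<noteq> 0 \<and> (\<forall>j\<in>views-{i}. l \<bullet> e i j = 0)" if "i \<in> views" for i
    using hyps(4)[rule_format, OF that] unfolding on_common_line_def by blast
  have e_indep: "\<alpha> = 0 \<and> \<beta> = 0"
    if "i \<in> views" "j \<in> views" "k \<in> views" "distinct [i, j, k]" "\<alpha> *\<^sub>R e i j + \<beta> *\<^sub>R e i k = 0" for i j k \<alpha> \<beta>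
    using distinct_points_independent[of "e i j" "e i k" \<alpha> \<beta>] e_nz e_ne that by auto
  \<comment> \<open>Nonzero factors that scale the epipoles of one view to sum zero; they exist
    because the three points are distinct and collinear.\<close>
  have "\<exists>a. (\<forall>j\<in>views-{i}. a j \<noteq> 0) \<and> (\<Sum>j\<in>views-{i}. a j *\<^sub>R e i j) = 0" if i: "i \<in> views" for i
  proof -
    obtain j k l where d: "distinct [i, j, k, l]" "views = {i, j, k, l}"
      using index_complement[OF i] by metis
    then have v: "j \<in> views" "k \<in> views" "l \<in> views" by blast+
    obtain n where "n \<noteq> 0" "\<forall>j\<in>views-{i}. n \<bullet> e i j = 0" using e_line[OF i] by blast
    then obtain \<alpha> \<beta> where ab: "\<alpha> \<noteq> 0" "\<beta> \<noteq> 0" "e i l = \<alpha> *\<^sub>R e i j + \<beta> *\<^sub>R e i k"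
      using collinear_points_relation[of "e i j" "e i k" "e i l" n] e_nz e_ne i v d(1) by auto
    define a where "a m = (if m = j then \<alpha> else if m = k then \<beta> else - 1)" for m
    have V: "views - {i} = {j, k, l}" using d by auto
    have "(\<Sum>j\<in>views-{i}. a j *\<^sub>R e i j) = 0"
      unfolding V using d(1) ab(3) by (simp add: a_def)
    then show ?thesis using ab(1,2) by (intro exI[of _ a]) (simp add: a_def)
  qed
  then have "\<forall>i\<in>views. \<exists>a. (\<forall>j\<in>views-{i}. a j \<noteq> 0) \<and> (\<Sum>j\<in>views-{i}. a j *\<^sub>R e i j) = 0" by blast
  then obtain a where "\<forall>i\<in>views. (\<forall>j\<in>views-{i}. a i j \<noteq> 0) \<and> (\<Sum>j\<in>views-{i}. a i j *\<^sub>R e i j) = 0"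
    using bchoice[of views "\<lambda>i a. (\<forall>j\<in>views-{i}. a j \<noteq> 0) \<and> (\<Sum>j\<in>views-{i}. a j *\<^sub>R e i j) = 0"] by blast
  then have a: "\<And>i j. i \<in> views \<Longrightarrow> j \<in> views \<Longrightarrow> i \<noteq> j \<Longrightarrow> a i j \<noteq> 0"
    "\<And>i. i \<in> views \<Longrightarrow> (\<Sum>j\<in>views-{i}. a i j *\<^sub>R e i j) = 0"
    by blast+
  define g where "g i j = (if i = j then 0 else a i j *\<^sub>R e i j)" for i j
  have g: "g i j = a i j *\<^sub>R e i j" if "i \<noteq> j" for i j using that by (simp add: g_def)
  interpret coplanar_views F g
  proof
    show "F j i = transpose (F i j)" if "i \<in> views" "j \<in> views" "i \<noteq> j" for i j
      using Ft[OF that] .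
    show "\<exists>t. v = t *\<^sub>R g j i" if ij: "i \<in> views" "j \<in> views" "i \<noteq> j" "F i j *v v = 0" for i j v
    proof -
      have "v \<in> span {e j i}" using e_ker[of j i v] ij by auto
      then obtain t where "v = t *\<^sub>R e j i" by (auto simp: span_singleton)
      then have "v = (t / a j i) *\<^sub>R g j i" using ij a(1)[of j i] by (simp add: g)
      then show ?thesis by blast
    qed
    show "F i j *v g j i = 0" if "i \<in> views" "j \<in> views" "i \<noteq> j" for i j
      using e_ker[of j i "e j i"] that by (simp add: g matrix_vector_mult_scaleR span_base)
    show "g i i = 0" for i by (simp add: g_def)
    show "(\<Sum>j\<in>views. g i j) = 0" if "i \<in> views" for i
    proof -
      have "finite views" by (simp add: views_def)
      then have "(\<Sum>j\<in>views. g i j) = (\<Sum>j\<in>views-{i}. g i j)"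
        using that by (simp add: sum.remove[of views i] g_def)
      also have "\<dots> = (\<Sum>j\<in>views-{i}. a i j *\<^sub>R e i j)" by (rule sum.cong) (auto simp: g)
      finally show ?thesis using a(2)[OF that] by simp
    qed
    show "b = 0 \<and> c = 0"
      if "i \<in> views" "j \<in> views" "k \<in> views" "distinct [i, j, k]" "b *\<^sub>R g i j + c *\<^sub>R g i k = 0" for i j k b c
      using e_indep[of i j k "b * a i j" "c * a i k"] that a(1)[of i j] a(1)[of i k] by (auto simp: g)
  qed
  have e: "e i j = (1 / a i j) *\<^sub>R g i j" if "i \<in> views" "j \<in> views" "i \<noteq> j" for i j
    using a(1)[OF that] that by (simp add: g)
  have e_bil: "bil (e i k) (F i j) (e j k) = 0 \<longleftrightarrow> bil (g i k) (F i j) (g j k) = 0"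
    if "i \<in> views" "j \<in> views" "k \<in> views" "distinct [i, j, k]" for i j k
    using that a(1)[of i k] a(1)[of j k] by (simp add: g bil_def matrix_vector_mult_scaleR)
  have coplanar_iff: "coplanar \<longleftrightarrow>
      (\<forall>i\<in>views. \<forall>j\<in>views. \<forall>k\<in>views. distinct [i, j, k] \<longrightarrow> bil (g i k) (F i j) (g j k) = 0)"
  proof
    assume R: "\<forall>i\<in>views. \<forall>j\<in>views. \<forall>k\<in>views. distinct [i, j, k] \<longrightarrow> bil (g i k) (F i j) (g j k) = 0"
    show coplanar
      unfolding coplanar_def
    proof (intro ballI impI)
      fix i j k assume v: "i \<in> views" "j \<in> views" "k \<in> views" "i \<noteq> j"
      show "bil (g i k) (F i j) (g j k) = 0"
        using R v by (cases "k = i \<or> k = j") (auto simp: g_self bil_def)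
    qed
  qed (auto simp: coplanar_def)
  \<comment> \<open>Distinct epipoles rule out the collinear alternative, and scaling does not
    affect vanishing.\<close>
  have triple_iff: "triplewise F e i j k \<longleftrightarrow> bil (g i k) (F i j) (g j k) = 0 \<and>
      bil (g i j) (F i k) (g k j) = 0 \<and> bil (g j i) (F j k) (g k i) = 0"
    if "i \<in> views" "j \<in> views" "k \<in> views" "distinct [i, j, k]" for i j k
    using that e_ne[of i j k] e_ne[of j i k] e_ne[of k i j] e_bil[of i j k] e_bil[of i k j] e_bil[of j k i]
    by (auto simp: triplewise_def triple_noncollinear_def triple_collinear_def)
  have triples: "?triples \<longleftrightarrow> coplanar"
    unfolding coplanar_iff views_atLeastAtMost using triple_iff by auto
  have x: "x 1 = F 1 2 *v e 2 4" "x 2 = F 2 1 *v e 1 4" "x 3 = F 3 1 *v e 1 4" "x 4 = F 4 1 *v e 1 3"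
    using x_def unfolding ordered_partitions by blast+
  have x_ex: "\<exists>j k. j \<in> views \<and> k \<in> views \<and> distinct [i, j, k] \<and> x i = F i j *v e j k" if "i \<in> views" for i
  proof -
    consider "i = 1" | "i = 2" | "i = 3" | "i = 4" using \<open>i \<in> views\<close> by (auto simp: views_def)
    then show ?thesis
    proof cases
      case 1 then show ?thesis using x(1) by (intro exI[of _ 2] exI[of _ 4]) auto
    next
      case 2 then show ?thesis using x(2) by (intro exI[of _ 1] exI[of _ 4]) auto
    next
      case 3 then show ?thesis using x(3) by (intro exI[of _ 1] exI[of _ 4]) auto
    next
      case 4 then show ?thesis using x(4) by (intro exI[of _ 1] exI[of _ 3]) auto
    qed
  qed
  have x: "\<exists>j k t. j \<in> views \<and> k \<in> views \<and> distinct [i, j, k] \<and> t \<noteq> 0 \<and> x i = t *\<^sub>R (F i j *v g j k)"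
    if i: "i \<in> views" for i
  proof -
    obtain j k where "j \<in> views" "k \<in> views" "distinct [i, j, k]" "x i = F i j *v e j k"
      using x_ex[OF i] by blast
    then show ?thesis
      using a(1)[of j k] e[of j k]
      by (intro exI[of _ j] exI[of _ k] exI[of _ "1 / a j k"]) (simp add: matrix_vector_mult_scaleR)
  qed
  \<comment> \<open>Coplanarity may be assumed: it follows from compatibility by
    \<open>compatible_imp_coplanar\<close> and is equivalent to (1) by
    \<open>triples\<close>.\<close>
  have main: "compatible 4 F \<longleftrightarrow> ?cycles \<and> ?edges = 0" if c: coplanar
  proof -
    interpret coplanar_views_normals F g x
    proof
      show coplanar by (rule c)
      fix i assume i: "i \<in> views"
      then obtain j k t where jk: "j \<in> views" "k \<in> views" "distinct [i, j, k]" "t \<noteq> 0" "x i = t *\<^sub>R (F i j *v g j k)"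
        using x by blast
      then show "x i \<noteq> 0" using F_g_neq_0[of i j k] i by simp
      fix b assume "b \<in> views"
      then have "bil (g i b) (F i j) (g j k) = 0" using bil_plane[OF c i jk(1)] jk by auto
      then show "x i \<bullet> g i b = 0" unfolding jk by (simp add: bil_def inner_commute)
    qed
    have m: "bil (x i) (F i j) (e j k) = m i j k / a j k" "bil (e j k) (F j i) (x i) = m i j k / a j k"
      if "i \<in> views" "j \<in> views" "k \<in> views" "i \<noteq> j" "j \<noteq> k" for i j k
      using that bil_transposed[of i j "e j k" "x i"] e[of j k]
      by (simp_all add: m_def bil_def matrix_vector_mult_scaleR)
    \<comment> \<open>The scales of the epipoles cancel in (3) except \<open>a 4 1\<close>, which
      occurs once in every term.\<close>
    have "?edges = a 4 1 * edge_expression m W"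
      using a(1) m_nonzeros
      by (simp add: m edge_expression_def W_def[symmetric] del: One_nat_def) (simp add: ring_distribs mult_ac)
    then have edges: "?edges = 0 \<longleftrightarrow> edge_expression m W = 0" using a(1)[of 4 1] by simp
    have "((F j k *v e k i) \<bullet> (F j l *v e l i)) * ((F k j *v e j i) \<bullet> (F k l *v e l i)) *
         ((F l j *v e j i) \<bullet> (F l k *v e k i)) +
       (norm (F l j *v e j i))\<^sup>2 * (norm (F j k *v e k i))\<^sup>2 * (norm (F k l *v e l i))\<^sup>2 = 0 \<longleftrightarrow>
       cyclic m i j k l"
      if "i \<in> views" "j \<in> views" "k \<in> views" "l \<in> views" "distinct [i, j, k, l]" for i j k l
    proof -
      define n where "n p = (norm (x p))\<^sup>2" for p
      \<comment> \<open>The vectors of (2) in view \<open>p\<close> are the multiples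
        \<open>\<mu> p q\<close> of \<open>x p\<close>, so each inner product is a product of two
        such factors and \<open>n p\<close>.\<close>
      define \<mu> where "\<mu> p q = m p q i / (a q i * n p)" for p q
      have n: "n p \<noteq> 0" if "p \<in> views" for p using x_nz[OF that] by (simp add: n_def)
      have par: "F p q *v e q i = \<mu> p q *\<^sub>R x p" if "p \<in> views" "q \<in> views" "p \<noteq> q" "q \<noteq> i" for p q
        using that F_g_parallel_x[of p q i] e[of q i] \<open>i \<in> views\<close>
        by (simp add: \<mu>_def n_def matrix_vector_mult_scaleR)
      have sq: "(norm (c *\<^sub>R x p))\<^sup>2 = c\<^sup>2 * n p" "(c *\<^sub>R x p) \<bullet> (d *\<^sub>R x p) = c * d * n p" for c d p
        by (simp_all add: n_def power_mult_distrib power2_norm_eq_inner)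
      have v: "j \<in> views" "k \<in> views" "l \<in> views" "i \<in> views" and
        ne: "j \<noteq> k" "j \<noteq> l" "k \<noteq> l" "k \<noteq> j" "l \<noteq> j" "l \<noteq> k" "j \<noteq> i" "k \<noteq> i" "l \<noteq> i"
        using that by auto
      \<comment> \<open>The factors \<open>\<mu>\<close> along the cycle \<open>j\<close>,
        \<open>k\<close>, \<open>l\<close> occur in both summands of (2) and are nonzero; what is
        left is \<open>cyclic\<close> over a nonzero denominator.\<close>
      have "((F j k *v e k i) \<bullet> (F j l *v e l i)) * ((F k j *v e j i) \<bullet> (F k l *v e l i)) *
          ((F l j *v e j i) \<bullet> (F l k *v e k i)) +
          (norm (F l j *v e j i))\<^sup>2 * (norm (F j k *v e k i))\<^sup>2 * (norm (F k l *v e l i))\<^sup>2 =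
          (n j * n k * n l) * (\<mu> j k * \<mu> k l * \<mu> l j) * (\<mu> j l * \<mu> k j * \<mu> l k + \<mu> l j * \<mu> j k * \<mu> k l)"
        by (simp only: par v ne not_False_eq_True sq) (simp add: algebra_simps power2_eq_square)
      also have "\<mu> j l * \<mu> k j * \<mu> l k + \<mu> l j * \<mu> j k * \<mu> k l =
          (m j l i * m k j i * m l k i + m l j i * m j k i * m k l i) /
          (a j i * a k i * a l i * n j * n k * n l)"
        using n[OF v(1)] n[OF v(2)] n[OF v(3)] a(1)[OF v(1,4)] a(1)[OF v(2,4)] a(1)[OF v(3,4)] ne
        by (simp add: \<mu>_def field_simps)
      finally show ?thesis
        using n[OF v(1)] n[OF v(2)] n[OF v(3)] a(1)[OF v(1,4)] a(1)[OF v(2,4)] a(1)[OF v(3,4)] v ne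
          m_neq_0[of j k i] m_neq_0[of k l i] m_neq_0[of l j i]
        by (simp add: cyclic_def \<mu>_def)
    qed
    then have "?cycles \<longleftrightarrow> cyclic m 1 2 3 4 \<and> cyclic m 2 1 3 4 \<and> cyclic m 3 1 2 4 \<and> cyclic m 4 1 2 3"
      unfolding ordered_partitions by simp
    then show ?thesis unfolding edges compatible_iff_equations by blast
  qed
  show ?thesis using main triples compatible_imp_coplanar by blast
qed

end
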